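(* Let $X$ be a real separable Hilbert space, $(T_t)_{t\ge 0}$ a strongly continuous semigroup of bounded linear operators on $X$ with infinitesimal generator $A$, let $b\in X$, let $M$ be a Lévy measure on $X$, and let $(P_t)_{t\ge 0}$ be the generalised Mehler semigroup associated with $(T_t)_{t\ge0}$ and the characteristics $[b,0,M]$. Assume: (1) there is an orthonormal basis $\{h_n\mid n\in\mathbb N\}$ of $X$ consisting of eigenvectors of $A^*$, and $\int_{B_1^c}|x|\,M(dx)<\infty$; (2) the limit $b_\infty:=\lim_{t\to\infty}b_t$ exists in $X$; (3) $\int_0^\infty\int_X(1\wedge|T_sx|^2)\,M(dx)\,ds<\infty$; (4) $\lim_{t\to\infty}T_tx=0$ for every $x\in X$; (5) there is a function $h:(0,\infty)\to(0,\infty)$ with $h\in L^1((0,\infty))$ such that $h(t)M-M\circ T_t^{-1}$ is a positive measure for every $t>0$. Let $\sigma$ be the unique invariant probability measure of $(P_t)_{t\ge0}$. Then, for every $p\in[1,\infty)$ and every $f\in\mathcal{F}C^2_A(X)$ with positive infimum, $$\mathrm{Ent}_\sigma(f^p)\le C\int_X\int_X\frac{|f^p(x+y)-f^p(x)|^2}{f^p(x)}\,M(dy)\,\sigma(dx),\qquad C=\|h\|_{L^1((0,\infty))}.$$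
   Context: $X$ may be finite or infinite dimensional, with inner product $\langle\cdot,\cdot\rangle$ and norm $|\cdot|$; $X^*$ is identified with $X$; $B_1$ is the open unit ball centred at $0$ and $B_1^c$ its complement. $B_b(X)$ is the space of bounded Borel functions $X\to\mathbb R$. A Lévy measure on $X$ is a Borel measure $M$ with $M(\{0\})=0$ and $\int_X(1\wedge|x|^2)M(dx)<\infty$. For $T\in\mathcal L(X)$, $(M\circ T^{-1})(B)=M(T^{-1}(B))$. Mehler semigroup: set $\lambda(\xi)=-i\langle\xi,b\rangle-\int_X\big(e^{i\langle x,\xi\rangle}-1-i\langle x,\xi\rangle\chi_{B_1}(x)\big)M(dx)$. Standing assumption: $\lambda$ is continuous for the Sazonov topology (the topology generated by the seminorms $x\mapsto|Tx|$, $T$ Hilbert–Schmidt on $X$). For $t\ge0$, $\mu_t$ is the Borel probability measure on $X$ with characteristic function $\widehat{\mu_t}(\xi)=\exp\big(-\int_0^t\lambda(T_s^*\xi)ds\big)$, and $(P_tf)(x)=\int_Xf(T_tx+y)\mu_t(dy)$ for $f\in B_b(X)$. Moreover $$b_t=\int_0^tT_sb\,ds+\int_0^t\int_XT_sx\big(\chi_{B_1}(T_sx)-\chi_{B_1}(x)\big)M(dx)ds.$$ Invariant measure: a Borel probability measure $\sigma$ is invariant if $\int_XP_tf\,d\sigma=\int_Xf\,d\sigma$ for all $t\ge0$, $f\in B_b(X)$. Under (1)–(4) it is known that there is exactly one invariant measure $\sigma$; it is the infinitely divisible law with Lévy–Khinchine characteristics $[b_\infty,0,M_\infty]$, where $M_\infty(\{0\})=0$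 and $M_\infty(B)=\int_0^\infty M(T_s^{-1}(B))ds$ for Borel $B\not\ni0$; also $\mu_t\to\sigma$ weakly as $t\to\infty$. $\mathcal{F}C^2_A(X)$ is the set of functions $F(x)=f(\langle x,h_1\rangle,\dots,\langle x,h_n\rangle)$ with $n\in\mathbb N$ and $f\in C^2_b(\mathbb R^n)$ (bounded with bounded continuous first and second derivatives), $\{h_n\}$ being the basis in (1). For positive $f$: $m_\sigma(f)=\int_Xf\,d\sigma$ and $\mathrm{Ent}_\sigma(f)=\int_Xf\log f\,d\sigma-m_\sigma(f)\log m_\sigma(f)$. *)

theory Defs
  imports "HOL-Probability.Probability"
begin

text \<open>Real separable Hilbert spaces are the types of sort
  \<open>{real_inner, banach, second_countable_topology}\<close>; they may be of finite or infinite dimension.\<close>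

section \<open>Semigroups, generators and orthonormal bases\<close>

definition C0_semigroup :: "(real \<Rightarrow> 'a::real_normed_vector \<Rightarrow>\<^sub>L 'a) \<Rightarrow> bool" where
  "C0_semigroup T \<longleftrightarrow>
     T 0 = id_blinfun \<and>
     (\<forall>s\<ge>0. \<forall>t\<ge>0. T (s + t) = T s o\<^sub>L T t) \<and>
     (\<forall>x. continuous_on {0..} (\<lambda>t. T t x))"

text \<open>Unbounded operators are represented by their graphs; membership of \<open>(x, y)\<close> means
  that \<open>x\<close> lies in the domain and is mapped to \<open>y\<close>.\<close>

definition generator :: "(real \<Rightarrow> 'a::real_normed_vector \<Rightarrow>\<^sub>L 'a) \<Rightarrow> ('a \<times> 'a) set" where
  "generator T = {(x, y). ((\<lambda>t. (T t x - x) /\<^sub>R t) \<longlongrightarrow> y) (at_right 0)}"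

definition graph_adjoint :: "('a::real_inner \<times> 'a) set \<Rightarrow> ('a \<times> 'a) set" where
  "graph_adjoint G = {(u, v). \<forall>(x, y)\<in>G. y \<bullet> u = x \<bullet> v}"

definition eigenvector :: "('a::real_vector \<times> 'a) set \<Rightarrow> 'a \<Rightarrow> bool" where
  "eigenvector G u \<longleftrightarrow> u \<noteq> 0 \<and> (\<exists>c::real. (u, c *\<^sub>R u) \<in> G)"

text \<open>The basis is \<open>e 0, e 1, \<dots>\<close>, with \<open>d \<le> \<infinity>\<close> the (Hilbert space) dimension;
  only the values \<open>e i\<close> with \<open>i < d\<close> matter.\<close>

definition orthonormal_basis :: "enat \<Rightarrow> (nat \<Rightarrow> 'a::real_inner) \<Rightarrow> bool" where
  "orthonormal_basis d e \<longleftrightarrow>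
     (\<forall>i j. enat i < d \<longrightarrow> enat j < d \<longrightarrow> e i \<bullet> e j = (if i = j then 1 else 0)) \<and>
     closure (span (e ` {i. enat i < d})) = UNIV"

section \<open>The Sazonov topology\<close>

definition hilbert_schmidt :: "('a::real_inner \<Rightarrow>\<^sub>L 'a) \<Rightarrow> bool" where
  "hilbert_schmidt S \<longleftrightarrow>
     (\<exists>d e. orthonormal_basis d e \<and> (\<lambda>i. (norm (S (e i)))\<^sup>2) summable_on {i. enat i < d})"

definition sazonov_topology :: "'a::real_inner topology" where
  "sazonov_topology =
     topology_generated_by {{y. norm (blinfun_apply S (y - x)) < r} | S x r. hilbert_schmidt S \<and> 0 < r}"

section \<open>Levy measures and generalised Mehler semigroups\<close>

definition levy_measure :: "'a::real_normed_vector measure \<Rightarrow> bool" where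
  "levy_measure M \<longleftrightarrow>
     sets M = sets borel \<and> emeasure M {0} = 0 \<and>
     (\<integral>\<^sup>+x. ennreal (min 1 ((norm x)\<^sup>2)) \<partial>M) < \<infinity>"

text \<open>The exponent of the triple \<open>[b, 0, M]\<close> (no Gaussian part).\<close>

definition levy_exponent :: "'a::real_inner \<Rightarrow> 'a measure \<Rightarrow> 'a \<Rightarrow> complex" where
  "levy_exponent b M \<xi> =
     - (\<i> * complex_of_real (\<xi> \<bullet> b))
     - (LINT x|M. exp (\<i> * complex_of_real (x \<bullet> \<xi>)) - 1
                  - \<i> * complex_of_real (x \<bullet> \<xi> * indicator (ball 0 1) x))"

definition char_fun :: "'a::real_inner measure \<Rightarrow> 'a \<Rightarrow> complex" where
  "char_fun m \<xi> = (LINT x|m. exp (\<i> * complex_of_real (x \<bullet> \<xi>)))"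

definition mehler_measures ::
    "(real \<Rightarrow> 'a::real_inner \<Rightarrow>\<^sub>L 'a) \<Rightarrow> 'a \<Rightarrow> 'a measure \<Rightarrow> (real \<Rightarrow> 'a measure) \<Rightarrow> bool" where
  "mehler_measures T b M \<mu> \<longleftrightarrow>
     (\<forall>t\<ge>0. prob_space (\<mu> t) \<and> sets (\<mu> t) = sets borel \<and>
        (\<forall>\<xi>. char_fun (\<mu> t) \<xi> =
           exp (- (LINT s:{0..t}|lborel. levy_exponent b M (adjoint (blinfun_apply (T s)) \<xi>)))))"

definition mehler_semigroup ::
    "(real \<Rightarrow> 'a::real_normed_vector \<Rightarrow>\<^sub>L 'a) \<Rightarrow> (real \<Rightarrow> 'a measure) \<Rightarrow> real \<Rightarrow> ('a \<Rightarrow> real) \<Rightarrow> 'a \<Rightarrow> real" where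
  "mehler_semigroup T \<mu> t f x = (LINT y|\<mu> t. f (T t x + y))"

definition mehler_drift ::
    "(real \<Rightarrow> 'a \<Rightarrow>\<^sub>L 'a) \<Rightarrow> 'a \<Rightarrow> 'a measure \<Rightarrow> real
       \<Rightarrow> 'a::{real_inner, banach, second_countable_topology}" where
  "mehler_drift T b M t =
     (LINT s:{0..t}|lborel. T s b) +
     (LINT s:{0..t}|lborel. LINT x|M.
        (indicator (ball 0 1) (T s x) - indicator (ball 0 1) x :: real) *\<^sub>R T s x)"

definition bounded_borel :: "('a::topological_space \<Rightarrow> real) set" where
  "bounded_borel = {f. f \<in> borel_measurable borel \<and> bounded (range f)}"

definition invariant_measure ::
    "(real \<Rightarrow> ('a::topological_space \<Rightarrow> real) \<Rightarrow> 'a \<Rightarrow> real) \<Rightarrow> 'a measure \<Rightarrow> bool" where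
  "invariant_measure P \<sigma> \<longleftrightarrow>
     prob_space \<sigma> \<and> sets \<sigma> = sets borel \<and>
     (\<forall>t\<ge>0. \<forall>f\<in>bounded_borel. (LINT x|\<sigma>. P t f x) = (LINT x|\<sigma>. f x))"

text \<open>\<open>N1 - N2\<close> is a positive measure. Both may be infinite, so the difference is
  characterised additively rather than by subtracting values.\<close>

definition positive_difference :: "'a measure \<Rightarrow> 'a measure \<Rightarrow> bool" where
  "positive_difference N1 N2 \<longleftrightarrow>
     (\<exists>\<nu>. sets \<nu> = sets N1 \<and>
        (\<forall>B\<in>sets N1. emeasure N1 B = emeasure N2 B + emeasure \<nu> B))"

section \<open>Cylindrical functions and entropy\<close>

definition C2_bounded :: "('v::real_normed_vector \<Rightarrow> real) set" where
  "C2_bounded = {f. bounded (range f) \<and>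
     (\<exists>(f' :: 'v \<Rightarrow> 'v \<Rightarrow>\<^sub>L real) (f'' :: 'v \<Rightarrow> 'v \<Rightarrow>\<^sub>L ('v \<Rightarrow>\<^sub>L real)).
        (\<forall>x. (f has_derivative blinfun_apply (f' x)) (at x)) \<and>
        (\<forall>x. (f' has_derivative blinfun_apply (f'' x)) (at x)) \<and>
        continuous_on UNIV f' \<and> bounded (range f') \<and>
        continuous_on UNIV f'' \<and> bounded (range f''))}"

text \<open>The functions \<open>f (x \<bullet> e 0, \<dots>, x \<bullet> e (n - 1))\<close> with \<open>n = CARD('n)\<close>; the bijection \<open>k\<close>
  numbers the coordinates of \<open>real ^ 'n\<close>. The full class of cylindrical functions is obtained
  by letting \<open>'n\<close> range over all finite types.\<close>

definition cylindrical_C2 ::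
    "'n::finite itself \<Rightarrow> enat \<Rightarrow> (nat \<Rightarrow> 'a::real_inner) \<Rightarrow> ('a \<Rightarrow> real) set" where
  "cylindrical_C2 _ d e = {F. enat CARD('n) \<le> d \<and>
     (\<exists>(f :: real ^ 'n \<Rightarrow> real) (k :: 'n \<Rightarrow> nat).
        f \<in> C2_bounded \<and> bij_betw k UNIV {..<CARD('n)} \<and>
        F = (\<lambda>x. f (\<chi> i. x \<bullet> e (k i))))}"

definition ent :: "'a measure \<Rightarrow> ('a \<Rightarrow> real) \<Rightarrow> real" where
  "ent m f = (LINT x|m. f x * ln (f x)) - (LINT x|m. f x) * ln (LINT x|m. f x)"

end

theory Submission
  imports Defs
begin

text \<open>
  No differentiation of the entropy along the semigroup is needed. The cylindrical function only
  sees the coordinates in the directions of finitely many eigenvectors of \<open>A\<^sup>*\<close>, so everything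
  happens in \<open>real ^ 'n\<close>. There the projection of \<open>\<mu> t\<close> is a limit of laws of random walks whose steps
  vanish with probability close to \<open>1\<close> and jump otherwise according to the image of \<open>ds \<otimes> M\<close>, with
  the small jumps removed, under \<open>(s, x) \<mapsto> T s x\<close>. For a random walk, the chain rule of the entropy
  reduces the claim to one step, where \<open>ln u \<le> u - 1\<close> bounds the entropy by variance over mean; the
  Cauchy-Schwarz inequality carries the bound through the remaining steps. By hypothesis the image
  measure is at most \<open>\<parallel>h\<parallel> M\<close>, which gives the constant. The inequality passes to \<open>\<mu> t\<close>, and
  as \<open>t \<rightarrow> \<infinity>\<close> to \<open>\<sigma>\<close>, by a multivariate version of Levy's continuity theorem.\<close>

section \<open>Bounded Borel functions\<close>

text \<open>The obstacle is the denominator. The one-step bound divides by the mean of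
  \<open>f^p\<close> after the step, whereas the claim has the value of \<open>f^p\<close> before
  the jump. A step that stays put with probability at least 1 - q makes this mean at least 1 - q
  times that value, and the same inequality moves the energy from the start of the step to its end.
  The price 1 / (1 - q)^2 is paid once and not once per step, because averaging over a step does not
  increase the energy: u^2 / w is jointly convex, and translations commute, so that jumping and
  averaging can be interchanged. Hence m steps cost m times the energy of one step, which is an
  integral against the jump measure, and letting q tend to 0 loses nothing. Removing small jumps
  makes the jump measure finite, but its mass may grow without bound as the cut-off radius shrinks.
  The number of steps has to outgrow the square of the mass: then both q and the distance between
  the walk and the compound Poisson law vanish. Drift and compensator go into the deterministic
  starting point, where the entropy estimate does not see them.\<close>

lemma bounded_borel_integrable:
  assumes "finite_measure N" "sets N = sets borel" "f \<in> bounded_borel"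
  shows "integrable N f"
proof -
  interpret finite_measure N by fact
  obtain B where "\<And>x. \<bar>f x\<bar> \<le> B"
    using assms(3) by (auto simp: bounded_borel_def bounded_iff)
  then show ?thesis
    using assms by (intro integrable_const_bound[where B = B]) (auto simp: bounded_borel_def)
qed

lemma bounded_borelI:
  assumes "f \<in> borel_measurable borel" "\<And>x. \<bar>f x\<bar> \<le> B"
  shows "f \<in> bounded_borel"
  using assms unfolding bounded_borel_def bounded_iff by auto

lemma bounded_borelE:
  assumes "f \<in> bounded_borel"
  obtains B where "f \<in> borel_measurable borel" "\<And>x. \<bar>f x\<bar> \<le> B" "0 \<le> B"
proof -
  obtain B where B: "\<And>x. \<bar>f x\<bar> \<le> B"
    using assms by (auto simp: bounded_borel_def bounded_iff)
  have "0 \<le> B" using B[of undefined] by linarith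
  with B show ?thesis using that assms by (auto simp: bounded_borel_def)
qed

lemma bounded_borel_compose:
  assumes "f \<in> bounded_borel" "g \<in> borel_measurable borel"
  shows "(\<lambda>x. f (g x)) \<in> bounded_borel"
  using assms(1)
proof (rule bounded_borelE)
  fix B assume [measurable]: "f \<in> borel_measurable borel" and "\<And>x. \<bar>f x\<bar> \<le> B"
  then show ?thesis using assms(2) by (intro bounded_borelI[where B = B]) auto
qed

lemma bounded_borel_translate:
  fixes f :: "'b::euclidean_space \<Rightarrow> real"
  assumes "f \<in> bounded_borel"
  shows "(\<lambda>y. f (x + y)) \<in> bounded_borel"
  by (rule bounded_borel_compose[OF assms]) simp

lemma bounded_borel_average:
  fixes \<kappa> :: "'b::topological_space measure" and f :: "'a::topological_space \<Rightarrow> 'b \<Rightarrow> real"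
  assumes "prob_space \<kappa>" "sets \<kappa> = sets borel"
    and "case_prod f \<in> borel_measurable (borel \<Otimes>\<^sub>M borel)" "\<And>x y. \<bar>f x y\<bar> \<le> B"
  shows "(\<lambda>x. LINT y|\<kappa>. f x y) \<in> bounded_borel"
proof (rule bounded_borelI[where B = B])
  interpret prob_space \<kappa> by fact
  note assms(2)[measurable_cong] assms(3)[measurable]
  show "(\<lambda>x. LINT y|\<kappa>. f x y) \<in> borel_measurable borel" by measurable
  fix x
  have "f x \<in> borel_measurable borel"
    using measurable_compose[OF measurable_Pair1' assms(3), of x] by simp
  then have i: "integrable \<kappa> (f x)"
    using assms by (intro integrable_const_bound[where B = B]) auto
  have "\<bar>LINT y|\<kappa>. f x y\<bar> \<le> (LINT y|\<kappa>. \<bar>f x y\<bar>)" by simp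
  also have "\<dots> \<le> B" using i by (intro integral_le_const) (auto simp: assms)
  finally show "\<bar>LINT y|\<kappa>. f x y\<bar> \<le> B" .
qed

section \<open>Random walks\<close>

text \<open>The recursion peels off the last step, which is the one that the entropy induction
  singles out. The deterministic start \<open>v\<close> will hold the drift minus the
  compensator.\<close>

primrec random_walk :: "'b::euclidean_space measure \<Rightarrow> 'b \<Rightarrow> nat \<Rightarrow> 'b measure" where
  "random_walk \<kappa> v 0 = return borel v"
| "random_walk \<kappa> v (Suc m) = distr (random_walk \<kappa> v m \<Otimes>\<^sub>M \<kappa>) borel (\<lambda>(x, y). x + y)"

lemma sets_random_walk [simp, measurable_cong]: "sets (random_walk \<kappa> v m) = sets borel"
  by (cases m) auto

lemma prob_space_random_walk:
  assumes "prob_space \<kappa>" "sets \<kappa> = sets borel"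
  shows "prob_space (random_walk \<kappa> v m)"
proof (induction m)
  case (Suc m)
  interpret a: prob_space "random_walk \<kappa> v m" by fact
  interpret b: prob_space \<kappa> by fact
  interpret pair_prob_space "random_walk \<kappa> v m" \<kappa> ..
  note assms(2)[measurable_cong]
  show ?case by (simp, rule prob_space_distr) measurable
qed (simp add: prob_space_return)

lemma integral_random_walk_Suc:
  fixes f :: "'b::euclidean_space \<Rightarrow> 'c::{banach, second_countable_topology}"
  assumes "prob_space \<kappa>" "sets \<kappa> = sets borel"
    and f [measurable]: "f \<in> borel_measurable borel" and B: "\<And>x. norm (f x) \<le> B"
  shows "(LINT x|random_walk \<kappa> v (Suc m). f x) = (LINT x|random_walk \<kappa> v m. LINT y|\<kappa>. f (x + y))"
proof -
  interpret a: prob_space "random_walk \<kappa> v m" by (rule prob_space_random_walk) fact+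
  interpret b: prob_space \<kappa> by fact
  interpret pair_prob_space "random_walk \<kappa> v m" \<kappa> ..
  note assms(2)[measurable_cong]
  have "integrable (random_walk \<kappa> v m \<Otimes>\<^sub>M \<kappa>) (\<lambda>(x, y). f (x + y))"
    by (rule integrable_const_bound[where B = B]) (auto simp: B)
  from integral_fst'[OF this] show ?thesis
    by (simp add: integral_distr split_beta')
qed

lemma char_fun_random_walk:
  assumes \<kappa>: "prob_space \<kappa>" "sets \<kappa> = sets borel"
  shows "char_fun (random_walk \<kappa> v m) \<xi> = exp (\<i> * complex_of_real (v \<bullet> \<xi>)) * char_fun \<kappa> \<xi> ^ m"
proof (induction m)
  case 0
  show ?case unfolding char_fun_def by (simp add: integral_return)
next
  case (Suc m)
  have "char_fun (random_walk \<kappa> v (Suc m)) \<xi> =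
    (LINT x|random_walk \<kappa> v m. LINT y|\<kappa>. exp (\<i> * complex_of_real ((x + y) \<bullet> \<xi>)))"
    unfolding char_fun_def by (rule integral_random_walk_Suc[OF \<kappa>, where B = 1]) auto
  also have "\<dots> = (LINT x|random_walk \<kappa> v m. exp (\<i> * complex_of_real (x \<bullet> \<xi>)) * char_fun \<kappa> \<xi>)"
    unfolding char_fun_def by (simp add: inner_add_left distrib_left exp_add)
  also have "\<dots> = char_fun (random_walk \<kappa> v m) \<xi> * char_fun \<kappa> \<xi>"
    by (simp add: char_fun_def)
  finally show ?case using Suc by simp
qed

section \<open>Entropy of a random walk\<close>

text \<open>The centre \<open>a\<close> is free because the variance is the least second moment. It
  will be the value of \<open>G\<close> before the step, which turns the numerator into the square
  in the energy.\<close>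

lemma ent_le_centered_second_moment:
  assumes "prob_space N" and G [measurable]: "G \<in> borel_measurable N"
    and c: "0 < c" "\<And>y. c \<le> G y" and B: "\<And>y. G y \<le> B"
  shows "ent N G \<le> (LINT y|N. (G y - a)\<^sup>2) / (LINT y|N. G y)"
proof -
  interpret prob_space N by fact
  have ab: "\<bar>G y\<bar> \<le> B" for y using c(1) c(2)[of y] B[of y] by linarith
  have i [simp]: "integrable N G"
    by (rule integrable_const_bound[where B = B]) (auto simp: ab)
  define u where "u = (LINT y|N. G y)"
  have u: "c \<le> u" unfolding u_def by (rule integral_ge_const) (auto simp: c)
  have i2 [simp]: "integrable N (\<lambda>y. (G y)\<^sup>2)"
    using power_mono[OF ab abs_ge_zero, where n = 2]
    by (intro integrable_const_bound[where B = "B\<^sup>2"]) auto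
  have i3 [simp]: "integrable N (\<lambda>y. G y * ln (G y))"
  proof (rule integrable_const_bound[where B = "B * (\<bar>ln c\<bar> + \<bar>ln B\<bar>)"])
    have "norm (G y * ln (G y)) \<le> B * (\<bar>ln c\<bar> + \<bar>ln B\<bar>)" for y
    proof -
      have "ln c \<le> ln (G y)" "ln (G y) \<le> ln B"
        using c(1) c(2)[of y] B[of y] by auto
      then show ?thesis using ab[of y] unfolding real_norm_def abs_mult
        by (intro mult_mono) auto
    qed
    then show "AE y in N. norm (G y * ln (G y)) \<le> B * (\<bar>ln c\<bar> + \<bar>ln B\<bar>)" by simp
  qed auto
  have "ent N G = (LINT y|N. G y * ln (G y) - ln u * G y)"
    by (simp add: ent_def u_def mult.commute)
  also have "\<dots> \<le> (LINT y|N. (G y)\<^sup>2 / u - G y)"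
  proof (rule integral_mono)
    fix y
    have p: "0 < G y" "0 < u" using c u order_less_le_trans by blast+
    have "ln (G y / u) \<le> G y / u - 1" using p by (intro ln_le_minus_one) auto
    then have "G y * ln (G y / u) \<le> G y * (G y / u - 1)" using p by (intro mult_left_mono) auto
    then show "G y * ln (G y) - ln u * G y \<le> (G y)\<^sup>2 / u - G y"
      using p by (simp add: ln_div algebra_simps power2_eq_square)
  qed auto
  also have "\<dots> = (LINT y|N. (G y)\<^sup>2) / u - u" by (simp add: u_def)
  also have "\<dots> = ((LINT y|N. (G y)\<^sup>2) - u\<^sup>2) / u"
    using u c by (simp add: diff_divide_distrib power2_eq_square)
  also have "\<dots> \<le> ((LINT y|N. (G y)\<^sup>2) - 2 * a * u + a\<^sup>2) / u"
  proof (rule divide_right_mono)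
    have "0 \<le> (u - a)\<^sup>2" by simp
    then show "(LINT y|N. (G y)\<^sup>2) - u\<^sup>2 \<le> (LINT y|N. (G y)\<^sup>2) - 2 * a * u + a\<^sup>2"
      by (simp add: power2_eq_square algebra_simps)
  qed (use u c in auto)
  also have "(LINT y|N. (G y)\<^sup>2) - 2 * a * u + a\<^sup>2 = (LINT y|N. (G y - a)\<^sup>2)"
    by (simp add: u_def power2_diff prob_space mult.assoc mult.commute)
  finally show ?thesis by (simp add: u_def)
qed

text \<open>Jensen's inequality for the jointly convex function u^2 / w, or Cauchy-Schwarz for g /
  sqrt w and sqrt w. It is what makes the energy decrease under averaging although the denominator
  is averaged too.\<close>

lemma square_integral_le:
  fixes g w :: "'b \<Rightarrow> real"
  assumes "prob_space N" and [measurable]: "g \<in> borel_measurable N" "w \<in> borel_measurable N"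
    and c: "0 < c" "\<And>y. c \<le> w y" and B: "\<And>y. w y \<le> B" "\<And>y. \<bar>g y\<bar> \<le> B"
  shows "(LINT y|N. g y)\<^sup>2 / (LINT y|N. w y) \<le> (LINT y|N. (g y)\<^sup>2 / w y)"
proof -
  interpret prob_space N by fact
  have [simp]: "integrable N g" by (rule integrable_const_bound[where B = B]) (auto simp: B)
  have ab: "\<bar>w y\<bar> \<le> B" for y using c(1) c(2)[of y] B(1)[of y] by linarith
  have [simp]: "integrable N w" by (rule integrable_const_bound[where B = B]) (auto simp: ab)
  have bd: "\<bar>(g y)\<^sup>2 / w y\<bar> \<le> B\<^sup>2 / c" for y
    using c(1) c(2)[of y] power_mono[OF B(2)[of y], of 2] by (auto intro!: frac_le simp: abs_mult)
  have [simp]: "integrable N (\<lambda>y. (g y)\<^sup>2 / w y)"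
    by (rule integrable_const_bound[where B = "B\<^sup>2 / c"]) (auto simp: bd simp del: abs_divide)
  define u where "u = (LINT y|N. w y)"
  have u: "c \<le> u" unfolding u_def by (rule integral_ge_const) (auto simp: c)
  \<comment> \<open>This \<open>a\<close> minimises the integral of (g - a w)^2 / w, and the minimum
    is the difference of the two sides.\<close>
  define a where "a = (LINT y|N. g y) / u"
  have "0 \<le> (LINT y|N. (g y)\<^sup>2 / w y - 2 * a * g y + a\<^sup>2 * w y)"
  proof (rule integral_nonneg_AE, rule AE_I2)
    fix y
    have p: "0 < w y" using c order_less_le_trans by blast
    then have "(g y)\<^sup>2 / w y - 2 * a * g y + a\<^sup>2 * w y = (g y - a * w y)\<^sup>2 / w y"
      by (simp add: field_simps power2_eq_square)
    then show "0 \<le> (g y)\<^sup>2 / w y - 2 * a * g y + a\<^sup>2 * w y" using p by simp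
  qed
  also have "\<dots> = (LINT y|N. (g y)\<^sup>2 / w y) - 2 * a * (LINT y|N. g y) + a\<^sup>2 * u"
    by (simp add: u_def)
  also have "\<dots> = (LINT y|N. (g y)\<^sup>2 / w y) - (LINT y|N. g y)\<^sup>2 / u"
    using u c by (simp add: a_def field_simps power2_eq_square)
  finally show ?thesis by (simp add: u_def)
qed

text \<open>The inner integral of the claim, with the step law in place of \<open>M\<close>.\<close>

definition walk_energy :: "'b::euclidean_space measure \<Rightarrow> ('b \<Rightarrow> real) \<Rightarrow> 'b \<Rightarrow> real" where
  "walk_energy \<kappa> G x = (LINT y|\<kappa>. (G (x + y) - G x)\<^sup>2 / G x)"

lemma walk_energy_integrand_bound:
  fixes c B a b :: real
  assumes "0 < c" "c \<le> a" "a \<le> B" "c \<le> b" "b \<le> B"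
  shows "\<bar>(b - a)\<^sup>2 / a\<bar> \<le> B\<^sup>2 / c"
proof -
  have "\<bar>b - a\<bar> \<le> B" using assms by linarith
  then have "(b - a)\<^sup>2 \<le> B\<^sup>2" using power_mono[of "\<bar>b - a\<bar>" B 2] by simp
  then show ?thesis using assms by (auto intro!: frac_le)
qed

lemma bounded_borel_walk_energy:
  assumes "prob_space \<kappa>" "sets \<kappa> = sets borel"
    and G: "G \<in> bounded_borel" and c: "0 < c" "\<And>x. c \<le> G x"
  shows "walk_energy \<kappa> G \<in> bounded_borel"
  using G
proof (rule bounded_borelE)
  fix B assume [measurable]: "G \<in> borel_measurable borel" and B: "\<And>x. \<bar>G x\<bar> \<le> B"
  show ?thesis unfolding walk_energy_def
    by (rule bounded_borel_average[OF assms(1,2), where B = "B\<^sup>2 / c"])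
      (auto intro!: walk_energy_integrand_bound c abs_le_D1[OF B] simp del: abs_divide)
qed

text \<open>The entropy splits into the mean entropy of the last step and the entropy of the
  averaged function under the shorter walk. The first is at most one, the second at most
  \<open>m\<close> times the integral of the energy of \<open>G\<close> under the longer walk, both
  with the same factor \<open>1 / (1 - q)\<^sup>2\<close>. The induction generalises
  \<open>G\<close> because its hypothesis is applied to the average.\<close>

lemma ent_random_walk_le:
  fixes G :: "'b::euclidean_space \<Rightarrow> real"
  assumes \<kappa>: "prob_space \<kappa>" "sets \<kappa> = sets borel" and q: "q < 1" "1 - q \<le> measure \<kappa> {0}"
    and G: "G \<in> bounded_borel" and c: "0 < c" "\<And>x. c \<le> G x"
  shows "ent (random_walk \<kappa> v m) G \<le> m / (1 - q)\<^sup>2 * (LINT x|random_walk \<kappa> v m. walk_energy \<kappa> G x)"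
  using G c
proof (induction m arbitrary: G)
  case 0
  then have "G \<in> borel_measurable borel" by (simp add: bounded_borel_def)
  then show ?case by (simp add: ent_def integral_return)
next
  case (Suc m)
  define N where "N = random_walk \<kappa> v m"
  define Q where "Q = (\<lambda>g x. LINT y|\<kappa>. g (x + y :: 'b) :: real)"
  interpret N: prob_space N unfolding N_def by (rule prob_space_random_walk) fact+
  interpret K: prob_space \<kappa> by fact
  interpret KK: pair_prob_space \<kappa> \<kappa> ..
  have sN [measurable_cong]: "sets N = sets borel" by (simp add: N_def)
  note \<kappa>(2)[measurable_cong]
  obtain B where [measurable]: "G \<in> borel_measurable borel" and B: "\<And>x. \<bar>G x\<bar> \<le> B"
    using Suc.prems(1) by (rule bounded_borelE) blast
  have B': "G x \<le> B" for x using B[of x] by simp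
  note c = Suc.prems(2,3)
  note integrable_N = bounded_borel_integrable[OF N.finite_measure_axioms sN]
  note integrable_K = bounded_borel_integrable[OF K.finite_measure_axioms \<kappa>(2)]
  have Q_bb: "Q g \<in> bounded_borel" if "g \<in> bounded_borel" for g
    using that
  proof (rule bounded_borelE)
    fix B assume [measurable]: "g \<in> borel_measurable borel" and B: "\<And>x. \<bar>g x\<bar> \<le> B"
    show ?thesis unfolding Q_def
      by (rule bounded_borel_average[OF \<kappa>, where B = B]) (auto simp: B)
  qed
  have Q_mono: "Q g x \<le> Q g' x" if "g \<in> bounded_borel" "g' \<in> bounded_borel" "\<And>x. g x \<le> g' x" for g g' x
    unfolding Q_def using that by (intro integral_mono integrable_K bounded_borel_translate) auto
  have Q_int: "(LINT x|random_walk \<kappa> v (Suc m). g x) = (LINT x|N. Q g x)" if "g \<in> bounded_borel" for g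
    using that unfolding Q_def N_def
    by (elim bounded_borelE, intro integral_random_walk_Suc[OF \<kappa>]) auto
  \<comment> \<open>The atom of the step law at 0 alone contributes this much, as \<open>g\<close>
    is nonnegative.\<close>
  have Q_ge: "(1 - q) * g x \<le> Q g x" if g: "g \<in> bounded_borel" "\<And>x. 0 \<le> g x" for g x
  proof -
    have "(1 - q) * g x \<le> measure \<kappa> {0} * g x" using q(2) g(2) by (rule mult_right_mono)
    also have "\<dots> = (LINT y|\<kappa>. indicator {0} y * g x)" by simp
    also have "\<dots> \<le> Q g x" unfolding Q_def
    proof (rule integral_mono)
      show "integrable \<kappa> (\<lambda>y. indicator {0} y * g x)"
        by (rule K.integrable_const_bound[where B = "\<bar>g x\<bar>"]) (auto simp: indicator_def)
    qed (use g in \<open>auto simp: indicator_def intro!: integrable_K bounded_borel_translate\<close>)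
    finally show ?thesis .
  qed
  define R where "R = walk_energy \<kappa> G"
  have R_bb: "R \<in> bounded_borel" unfolding R_def by (rule bounded_borel_walk_energy) fact+
  have R_nn: "0 \<le> R x" for x unfolding R_def walk_energy_def
    using c(1) c(2)[of x] by (intro integral_nonneg_AE AE_I2 divide_nonneg_pos) auto
  define \<eta> where "\<eta> = (\<lambda>x. G x * ln (G x))"
  have \<eta>_bb: "\<eta> \<in> bounded_borel" unfolding \<eta>_def
  proof (rule bounded_borelI[where B = "B * (\<bar>ln c\<bar> + \<bar>ln B\<bar>)"])
    fix x
    have "ln c \<le> ln (G x)" "ln (G x) \<le> ln B"
      using c(1) c(2)[of x] B'[of x] by auto
    then show "\<bar>G x * ln (G x)\<bar> \<le> B * (\<bar>ln c\<bar> + \<bar>ln B\<bar>)"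
      using B[of x] unfolding abs_mult by (intro mult_mono) auto
  qed auto
  have QG_ge: "c \<le> Q G x" for x unfolding Q_def
    using c bounded_borel_translate[OF Suc.prems(1)] by (intro K.integral_ge_const integrable_K) auto
  have QG_le: "Q G x \<le> B" for x unfolding Q_def
    using B' bounded_borel_translate[OF Suc.prems(1)] by (intro K.integral_le_const integrable_K) auto
  have [measurable]: "Q G \<in> borel_measurable borel" using Q_bb[OF Suc.prems(1)] by (simp add: bounded_borel_def)
  have QG_ln_bb: "(\<lambda>x. Q G x * ln (Q G x)) \<in> bounded_borel"
  proof (rule bounded_borelI[where B = "B * (\<bar>ln c\<bar> + \<bar>ln B\<bar>)"])
    fix x
    have "ln c \<le> ln (Q G x)" "ln (Q G x) \<le> ln B"
      using c(1) QG_ge[of x] QG_le[of x] by auto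
    then have "\<bar>ln (Q G x)\<bar> \<le> \<bar>ln c\<bar> + \<bar>ln B\<bar>" by linarith
    moreover have "\<bar>Q G x\<bar> \<le> B" using c(1) QG_ge[of x] QG_le[of x] by linarith
    ultimately show "\<bar>Q G x * ln (Q G x)\<bar> \<le> B * (\<bar>ln c\<bar> + \<bar>ln B\<bar>)"
      unfolding abs_mult by (intro mult_mono) auto
  qed auto
  \<comment> \<open>The chain rule: the integral of \<open>Q G x * ln (Q G x)\<close> is subtracted
    in one summand and added in the other.\<close>
  have ent_split: "ent (random_walk \<kappa> v (Suc m)) G = (LINT x|N. ent \<kappa> (\<lambda>y. G (x + y))) + ent N (Q G)"
  proof -
    have "ent \<kappa> (\<lambda>y. G (x + y)) = Q \<eta> x - Q G x * ln (Q G x)" for x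
      by (simp add: ent_def Q_def \<eta>_def)
    then have "(LINT x|N. ent \<kappa> (\<lambda>y. G (x + y))) = (LINT x|N. Q \<eta> x) - (LINT x|N. Q G x * ln (Q G x))"
      by (simp add: integrable_N Q_bb \<eta>_bb QG_ln_bb)
    moreover have "ent (random_walk \<kappa> v (Suc m)) G = (LINT x|N. Q \<eta> x) - (LINT x|N. Q G x) * ln (LINT x|N. Q G x)"
      using Q_int[OF Suc.prems(1)] Q_int[OF \<eta>_bb] unfolding ent_def \<eta>_def by presburger
    ultimately show ?thesis by (simp add: ent_def[of N])
  qed
  \<comment> \<open>The centre is \<open>G x\<close>. One factor 1 - q bounds the mean
    \<open>Q G x\<close> from below in terms of \<open>G x\<close>, the other replaces the energy at
    \<open>x\<close> by its average after the step.\<close>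
  have step: "ent \<kappa> (\<lambda>y. G (x + y)) \<le> Q R x / (1 - q)\<^sup>2" for x
  proof -
    have pos: "0 < G x" using c order_less_le_trans by blast
    have "ent \<kappa> (\<lambda>y. G (x + y)) \<le> (LINT y|\<kappa>. (G (x + y) - G x)\<^sup>2) / Q G x"
      unfolding Q_def using c B' pos
      by (intro ent_le_centered_second_moment[where c = c and B = B] K.prob_space_axioms) auto
    also have "\<dots> \<le> (LINT y|\<kappa>. (G (x + y) - G x)\<^sup>2) / ((1 - q) * G x)"
      using q pos Q_ge[OF Suc.prems(1), of x] c
      by (intro divide_left_mono mult_pos_pos integral_nonneg_AE)
         (auto intro: less_imp_le order_less_le_trans[OF c(1)] QG_ge)
    also have "\<dots> = R x / (1 - q)" by (simp add: R_def walk_energy_def)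
    also have "\<dots> \<le> (Q R x / (1 - q)) / (1 - q)"
      using Q_ge[OF R_bb R_nn, of x] q by (intro divide_right_mono) (auto simp: field_simps)
    finally show ?thesis by (simp add: power2_eq_square)
  qed
  have "(LINT x|N. ent \<kappa> (\<lambda>y. G (x + y))) \<le> (LINT x|N. Q R x / (1 - q)\<^sup>2)"
  proof (rule integral_mono)
    have "(\<lambda>x. ent \<kappa> (\<lambda>y. G (x + y))) = (\<lambda>x. Q \<eta> x - Q G x * ln (Q G x))"
      by (simp add: ent_def Q_def \<eta>_def)
    then show "integrable N (\<lambda>x. ent \<kappa> (\<lambda>y. G (x + y)))"
      by (simp add: integrable_N Q_bb \<eta>_bb QG_ln_bb)
  qed (auto intro!: step integrable_N Q_bb R_bb integrable_divide)
  also have "\<dots> = 1 / (1 - q)\<^sup>2 * (LINT x|random_walk \<kappa> v (Suc m). R x)"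
    by (simp add: Q_int[OF R_bb] del: random_walk.simps)
  finally have 1: "(LINT x|N. ent \<kappa> (\<lambda>y. G (x + y))) \<le> \<dots>" .
  \<comment> \<open>An increment of \<open>Q G\<close> is the average of increments of shifted
    copies of \<open>G\<close>. Jensen applies for each jump y, and swapping the integrals gives the
    average of \<open>R\<close>, because x + y + z is symmetric in y and z.\<close>
  have contraction: "walk_energy \<kappa> (Q G) x \<le> Q R x" for x
  proof -
    have sq: "(Q G (x + y) - Q G x)\<^sup>2 / Q G x \<le> (LINT z|\<kappa>. (G (x + y + z) - G (x + z))\<^sup>2 / G (x + z))" for y
    proof -
      have "Q G (x + y) - Q G x = (LINT z|\<kappa>. G (x + y + z) - G (x + z))"
        unfolding Q_def using bounded_borel_translate[OF Suc.prems(1)] by (simp add: integrable_K)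
      moreover have "\<bar>G u - G w\<bar> \<le> B" for u w
        using c(1) c(2)[of u] c(2)[of w] B'[of u] B'[of w] by linarith
      ultimately show ?thesis
        unfolding Q_def using c B' K.prob_space_axioms
        by (simp only:) (rule square_integral_le[where c = c and B = B], auto)
    qed
    have bb: "\<bar>(G u - G w)\<^sup>2 / G w\<bar> \<le> B\<^sup>2 / c" for u w
      by (intro walk_energy_integrand_bound c B')
    have "walk_energy \<kappa> (Q G) x \<le> (LINT y|\<kappa>. LINT z|\<kappa>. (G (x + y + z) - G (x + z))\<^sup>2 / G (x + z))"
      unfolding walk_energy_def
    proof (rule integral_mono)
      show "integrable \<kappa> (\<lambda>y. (Q G (x + y) - Q G x)\<^sup>2 / Q G x)"
        by (rule K.integrable_const_bound[where B = "B\<^sup>2 / c"])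
           (auto intro!: walk_energy_integrand_bound c QG_ge QG_le simp del: abs_divide)
      show "integrable \<kappa> (\<lambda>y. LINT z|\<kappa>. (G (x + y + z) - G (x + z))\<^sup>2 / G (x + z))"
        by (intro integrable_K bounded_borel_average[OF \<kappa>, where B = "B\<^sup>2 / c"]) (auto simp: bb simp del: abs_divide)
    qed (rule sq)
    also have "\<dots> = (LINT z|\<kappa>. LINT y|\<kappa>. (G (x + y + z) - G (x + z))\<^sup>2 / G (x + z))"
      by (rule KK.Fubini_integral[symmetric], rule KK.integrable_const_bound[where B = "B\<^sup>2 / c"])
         (auto simp: bb simp del: abs_divide)
    also have "\<dots> = Q R x"
      unfolding Q_def R_def walk_energy_def by (simp add: ac_simps)
    finally show ?thesis .
  qed
  have "ent N (Q G) \<le> m / (1 - q)\<^sup>2 * (LINT x|N. walk_energy \<kappa> (Q G) x)"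
    unfolding N_def by (rule Suc.IH) (auto intro: Q_bb Suc.prems c QG_ge)
  also have "\<dots> \<le> m / (1 - q)\<^sup>2 * (LINT x|N. Q R x)"
    using QG_ge c(1) by (intro mult_left_mono integral_mono integrable_N bounded_borel_walk_energy \<kappa> Q_bb Suc.prems(1) R_bb contraction) auto
  also have "\<dots> = m / (1 - q)\<^sup>2 * (LINT x|random_walk \<kappa> v (Suc m). R x)"
    by (simp add: Q_int[OF R_bb] del: random_walk.simps)
  finally have 2: "ent N (Q G) \<le> \<dots>" .
  show ?case
    using 1 2 by (simp add: ent_split R_def[symmetric] add_divide_distrib distrib_right del: random_walk.simps)
qed

section \<open>Convergence of characteristic functions\<close>

text \<open>On this class convergence of characteristic functions gives convergence of integrals by
  linearity; products stay inside because characters multiply.\<close>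

inductive trig_polynomial :: "('b::real_inner \<Rightarrow> complex) \<Rightarrow> bool" where
  monomial: "trig_polynomial (\<lambda>x. c * exp (\<i> * complex_of_real (x \<bullet> \<xi>)))"
| add: "trig_polynomial \<phi> \<Longrightarrow> trig_polynomial \<psi> \<Longrightarrow> trig_polynomial (\<lambda>x. \<phi> x + \<psi> x)"

lemma trig_polynomial_mult:
  assumes "trig_polynomial \<phi>" "trig_polynomial \<psi>"
  shows "trig_polynomial (\<lambda>x. \<phi> x * \<psi> x)"
  using assms
proof (induction arbitrary: \<psi>)
  case (monomial c \<xi>)
  from monomial show ?case
  proof induction
    case (monomial c' \<xi>')
    have "(\<lambda>x. c * exp (\<i> * complex_of_real (x \<bullet> \<xi>)) * (c' * exp (\<i> * complex_of_real (x \<bullet> \<xi>'))))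
      = (\<lambda>x. (c * c') * exp (\<i> * complex_of_real (x \<bullet> (\<xi> + \<xi>'))))"
      by (simp add: inner_add_right distrib_left exp_add mult_ac)
    then show ?case using trig_polynomial.monomial[of "c * c'" "\<xi> + \<xi>'"] by simp
  next
    case (add \<phi> \<psi>)
    then show ?case using trig_polynomial.add by (fastforce simp: distrib_left)
  qed
next
  case (add \<phi> \<phi>')
  then show ?case using trig_polynomial.add[of "\<lambda>x. \<phi> x * \<psi> x" "\<lambda>x. \<phi>' x * \<psi> x"] by (simp add: distrib_right)
qed

lemma trig_polynomial_const: "trig_polynomial (\<lambda>x. c)"
  using trig_polynomial.monomial[of c 0] by simp

lemma trig_polynomial_sum:
  assumes "\<And>i. i \<in> I \<Longrightarrow> trig_polynomial (\<phi> i)"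
  shows "trig_polynomial (\<lambda>x. \<Sum>i\<in>I. \<phi> i x)"
  using assms
  by (induction I rule: infinite_finite_induct) (auto intro: trig_polynomial_const trig_polynomial.add)

lemma trig_polynomial_sin: "trig_polynomial (\<lambda>x. complex_of_real (sin (x \<bullet> \<xi>)))"
proof -
  have "(\<lambda>x. complex_of_real (sin (x \<bullet> \<xi>))) =
    (\<lambda>x. 1 / (2 * \<i>) * exp (\<i> * complex_of_real (x \<bullet> \<xi>)) + (- 1 / (2 * \<i>)) * exp (\<i> * complex_of_real (x \<bullet> - \<xi>)))"
    by (auto simp: fun_eq_iff sin_of_real[symmetric] sin_exp_eq field_simps)
  then show ?thesis
    by (simp only:) (intro trig_polynomial.intros)
qed

lemma trig_polynomial_integral_tendsto:
  fixes N :: "nat \<Rightarrow> 'b::euclidean_space measure"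
  assumes N: "\<And>n. prob_space (N n)" "\<And>n. sets (N n) = sets borel" and L: "prob_space L" "sets L = sets borel"
    and lim: "\<And>\<xi>. (\<lambda>n. char_fun (N n) \<xi>) \<longlonglongrightarrow> char_fun L \<xi>"
    and "trig_polynomial \<phi>"
  shows "(\<lambda>n. LINT x|N n. \<phi> x) \<longlonglongrightarrow> (LINT x|L. \<phi> x)"
proof -
  interpret N: prob_space "N n" for n by (rule N)
  interpret L: prob_space L by fact
  note N(2)[measurable_cong] L(2)[measurable_cong]
  have "(\<forall>n. integrable (N n) \<phi>) \<and> integrable L \<phi> \<and> (\<lambda>n. LINT x|N n. \<phi> x) \<longlonglongrightarrow> (LINT x|L. \<phi> x)"
    using \<open>trig_polynomial \<phi>\<close>
  proof induction
    case (monomial c \<xi>)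
    have "integrable (N n) (\<lambda>x. c * exp (\<i> * complex_of_real (x \<bullet> \<xi>)))" for n
      by (rule N.integrable_const_bound[where B = "norm c"]) (auto simp: norm_mult)
    moreover have "integrable L (\<lambda>x. c * exp (\<i> * complex_of_real (x \<bullet> \<xi>)))"
      by (rule L.integrable_const_bound[where B = "norm c"]) (auto simp: norm_mult)
    ultimately show ?case
      using tendsto_mult_left[OF lim[of \<xi>], of c] by (simp add: char_fun_def)
  qed (auto intro!: tendsto_add)
  then show ?thesis by blast
qed

text \<open>Substituting sines turns the polynomials of the Stone-Weierstrass theorem into functions
  that characteristic functions control.\<close>

lemma polynomial_sin_trig_polynomial:
  fixes P :: "real ^ 'n \<Rightarrow> real"
  assumes "real_polynomial_function P"
  shows "trig_polynomial (\<lambda>x. complex_of_real (P (\<chi> i. sin (a * x $ i))))"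
  using assms
proof induction
  case (linear f)
  interpret bounded_linear f by fact
  have 1: "complex_of_real (f (\<chi> i. sin (a * x $ i))) =
    (\<Sum>i\<in>UNIV. complex_of_real (f (axis i 1)) * complex_of_real (sin (x \<bullet> axis i a)))" for x :: "real ^ 'n"
  proof -
    have "(\<chi> i. sin (a * x $ i)) = (\<Sum>i\<in>UNIV. sin (a * x $ i) *\<^sub>R axis i 1)"
      by (simp add: vec_eq_iff axis_def if_distrib sum.delta cong: if_cong)
    then have "f (\<chi> i. sin (a * x $ i)) = (\<Sum>i\<in>UNIV. sin (a * x $ i) * f (axis i 1))"
      by (simp add: sum scale)
    then show ?thesis by (simp add: inner_axis mult.commute)
  qed
  show ?case unfolding 1
    by (intro trig_polynomial_sum trig_polynomial_mult trig_polynomial_const trig_polynomial_sin)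
qed (auto intro: trig_polynomial_const trig_polynomial.add trig_polynomial_mult)

text \<open>The sines map the cube of half-width \<open>L\<close> homeomorphically onto the cube
  with sides [-1, 1], where a polynomial approximates the transported function. Elsewhere the
  approximant may be far from \<open>g\<close>, but the sines never leave that cube, so it is
  bounded by \<open>B + \<epsilon>\<close> on the whole space; the tail estimate needs this.\<close>

lemma continuous_approx_trig:
  fixes g :: "real ^ 'n \<Rightarrow> real"
  assumes g: "continuous_on UNIV g" "\<And>x. \<bar>g x\<bar> \<le> B" and "0 < L" "0 < \<epsilon>"
  obtains q where "trig_polynomial (\<lambda>x. complex_of_real (q x))" "continuous_on UNIV q"
    "\<And>x. \<bar>q x\<bar> \<le> B + \<epsilon>" "\<And>x. (\<And>i. \<bar>x $ i\<bar> \<le> L) \<Longrightarrow> \<bar>g x - q x\<bar> \<le> \<epsilon>"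
proof -
  \<comment> \<open>Then \<open>a * L\<close> is pi / 2, the range on which \<open>arcsin\<close>
    inverts the sine.\<close>
  define a where "a = pi / (2 * L)"
  have a: "0 < a" using assms by (simp add: a_def)
  define S :: "(real ^ 'n) set" where "S = cbox (- 1) 1"
  define G where "G = (\<lambda>s :: real ^ 'n. g (\<chi> i. arcsin (s $ i) / a))"
  have "continuous_on S (\<lambda>s. (\<chi> i. arcsin (s $ i) / a) :: real ^ 'n)"
    using a by (intro continuous_intros) (auto simp: S_def mem_box_cart one_vec_def)
  then have "continuous_on S G"
    unfolding G_def by (rule continuous_on_compose2[OF g(1)]) auto
  then obtain P where P: "real_polynomial_function P" "\<And>s. s \<in> S \<Longrightarrow> \<bar>G s - P s\<bar> < \<epsilon>"
    using Stone_Weierstrass_real_polynomial_function[of S G \<epsilon>] \<open>0 < \<epsilon>\<close> by (auto simp: S_def)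
  define q where "q = (\<lambda>x. P (\<chi> i. sin (a * x $ i)))"
  have S: "(\<chi> i. sin (a * x $ i)) \<in> S" for x by (simp add: S_def mem_box_cart)
  show thesis
  proof
    show "trig_polynomial (\<lambda>x. complex_of_real (q x))"
      unfolding q_def by (rule polynomial_sin_trig_polynomial) fact
    have "continuous_on UNIV P"
      using P(1) continuous_on_polymonial_function real_polynomial_function_eq by blast
    then show "continuous_on UNIV q" unfolding q_def
      by (rule continuous_on_compose2) (auto intro!: continuous_intros)
    show "\<bar>q x\<bar> \<le> B + \<epsilon>" for x
      using P(2)[OF S[of x]] g(2)[of "\<chi> i. arcsin ((\<chi> i. sin (a * x $ i)) $ i) / a"]
      unfolding q_def G_def by linarith
    fix x :: "real ^ 'n" assume x: "\<And>i. \<bar>x $ i\<bar> \<le> L"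
    have "arcsin (sin (a * x $ i)) = a * x $ i" for i
    proof -
      have "\<bar>a * x $ i\<bar> \<le> a * L" using x a by (simp add: abs_mult)
      also have "\<dots> = pi / 2" using \<open>0 < L\<close> by (simp add: a_def)
      finally show ?thesis by (intro arcsin_sin) auto
    qed
    then have "G (\<chi> i. sin (a * x $ i)) = g x" using a by (simp add: G_def)
    then show "\<bar>g x - q x\<bar> \<le> \<epsilon>" using P(2)[OF S[of x]] by (simp add: q_def)
  qed
qed

text \<open>Tightness comes from the one-dimensional continuity theorem applied to the coordinates.\<close>

theorem char_fun_tendsto_imp_integral_tendsto:
  fixes N :: "nat \<Rightarrow> (real ^ 'n) measure" and g :: "real ^ 'n \<Rightarrow> real"
  assumes N: "\<And>n. prob_space (N n)" "\<And>n. sets (N n) = sets borel" and K: "prob_space K" "sets K = sets borel"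
    and lim: "\<And>\<xi>. (\<lambda>n. char_fun (N n) \<xi>) \<longlonglongrightarrow> char_fun K \<xi>"
    and g: "continuous_on UNIV g" "\<And>x. \<bar>g x\<bar> \<le> B"
  shows "(\<lambda>n. LINT x|N n. g x) \<longlonglongrightarrow> (LINT x|K. g x)"
proof -
  interpret N: prob_space "N n" for n by (rule N)
  interpret K: prob_space K by fact
  note N(2)[measurable_cong] K(2)[measurable_cong]
  have B: "0 \<le> B" using g(2)[of 0] by linarith
  \<comment> \<open>Where some coordinate is large, |g - q| is at most 2 B + \<delta>, hence at most
    \<delta> + D.\<close>
  define D where "D = 2 * B + 1"
  have D: "0 \<le> D" "D = 2 * B + 1" using B by (simp_all add: D_def)
  \<comment> \<open>A continuous cut-off, 0 up to r and 1 from r + 1 on, so that weak convergence of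
    the marginals controls it. This is why the cube of the approximation has half-width r +
    1.\<close>
  define \<psi> where "\<psi> = (\<lambda>r u :: real. min 1 (max 0 (\<bar>u\<bar> - r)))"
  have \<psi>: "continuous_on UNIV (\<psi> r)" "0 \<le> \<psi> r u" "\<psi> r u \<le> 1" for r u
    unfolding \<psi>_def by (auto intro!: continuous_intros)
  have [measurable]: "\<psi> r \<in> borel_measurable borel" for r
    by (rule borel_measurable_continuous_onI) (rule \<psi>)
  have [measurable]: "g \<in> borel_measurable borel" by (rule borel_measurable_continuous_onI) (rule g)
  have marginal: "(\<lambda>n. LINT x|N n. \<psi> r (x $ i)) \<longlonglongrightarrow> (LINT x|K. \<psi> r (x $ i))" for r i
  proof -
    define p where "p = (\<lambda>x :: real ^ 'n. x $ i)"
    have p [measurable]: "p \<in> borel_measurable borel" unfolding p_def by simp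
    have rd: "real_distribution (distr (N n) borel p)" "real_distribution (distr K borel p)" for n
      unfolding real_distribution_def real_distribution_axioms_def
      by (auto intro!: N.prob_space_distr K.prob_space_distr)
    have ch: "char (distr R borel p) t = char_fun R (axis i t)" if "sets R = sets borel" for R t
    proof -
      note that[measurable_cong]
      show ?thesis unfolding char_def char_fun_def
        by (subst integral_distr) (auto simp: p_def inner_axis mult.commute)
    qed
    have "weak_conv_m (\<lambda>n. distr (N n) borel p) (distr K borel p)"
      by (rule levy_continuity) (auto intro!: rd lim simp: ch N K)
    then have "(\<lambda>n. LINT u|distr (N n) borel p. \<psi> r u) \<longlonglongrightarrow> (LINT u|distr K borel p. \<psi> r u)"
      by (rule weak_conv_imp_integral_bdd_continuous_conv[OF rd, where B = 1])
        (use \<psi> in \<open>auto simp: continuous_on_eq_continuous_at\<close>)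
    then show ?thesis by (simp add: integral_distr p_def)
  qed
  have tight: "(\<lambda>r. LINT x|K. \<psi> (real r) (x $ i)) \<longlonglongrightarrow> (LINT x|K. 0)" for i
  proof (rule integral_dominated_convergence[where w = "\<lambda>_. 1"])
    show "AE x in K. (\<lambda>r. \<psi> (real r) (x $ i)) \<longlonglongrightarrow> 0"
    proof (rule AE_I2, rule tendsto_eventually)
      fix x :: "real ^ 'n"
      obtain r0 :: nat where "\<bar>x $ i\<bar> \<le> r0" using real_arch_simple by blast
      then show "\<forall>\<^sub>F r in sequentially. \<psi> (real r) (x $ i) = 0"
        by (intro eventually_sequentiallyI[of r0]) (auto simp: \<psi>_def)
    qed
  qed (use \<psi> in auto)
  define \<Psi> where "\<Psi> = (\<lambda>r (x :: real ^ 'n). \<Sum>i\<in>UNIV. \<psi> r (x $ i))"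
  have \<psi>i: "integrable (N n) (\<lambda>x. \<psi> r (x $ i))" "integrable K (\<lambda>x. \<psi> r (x $ i))" for n r i
    using \<psi> by (auto intro!: N.integrable_const_bound[where B = 1] K.integrable_const_bound[where B = 1])
  have \<Psi>i: "integrable (N n) (\<Psi> r)" "integrable K (\<Psi> r)" for n r
    unfolding \<Psi>_def by (auto intro!: \<psi>i)
  have gi: "integrable (N n) g" "integrable K g" for n
    using g by (auto intro!: N.integrable_const_bound[where B = B] K.integrable_const_bound[where B = B])
  have tight': "(\<lambda>r. LINT x|K. \<Psi> (real r) x) \<longlonglongrightarrow> 0"
    unfolding \<Psi>_def using tendsto_sum[of UNIV, OF tight] by (simp add: \<psi>i)
  have marginal': "(\<lambda>n. LINT x|N n. \<Psi> r x) \<longlonglongrightarrow> (LINT x|K. \<Psi> r x)" for r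
    unfolding \<Psi>_def using tendsto_sum[of UNIV, OF marginal] by (simp add: \<psi>i)
  have triangle: "\<bar>u - w\<bar> < 2 * s + t" if "\<bar>u - u'\<bar> \<le> s" "\<bar>w - w'\<bar> \<le> s" "\<bar>u' - w'\<bar> < t"
    for u u' w w' s t :: real
    using that by linarith
  show ?thesis
  proof (rule LIMSEQ_I)
    fix \<epsilon> :: real assume "0 < \<epsilon>"
    \<comment> \<open>The errors will add up to less than 2 (\<delta> + D \<delta>) + \<delta> = (4
      B + 5) \<delta>.\<close>
    define \<delta> where "\<delta> = min 1 (\<epsilon> / (4 * B + 6))"
    have "\<delta> \<le> \<epsilon> / (4 * B + 6)" by (simp add: \<delta>_def)
    then have "\<delta> * (4 * B + 6) \<le> \<epsilon>" using B by (simp add: pos_le_divide_eq)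
    moreover have "0 < \<delta>" "\<delta> \<le> 1" using \<open>0 < \<epsilon>\<close> B by (auto simp: \<delta>_def)
    ultimately have \<delta>: "0 < \<delta>" "\<delta> \<le> 1" "\<delta> * (4 * B + 6) \<le> \<epsilon>" by blast+
    \<comment> \<open>The tail of \<open>K\<close> alone fixes the radius; for large n the tails of
      \<open>N n\<close> obey the same bound by \<open>marginal'\<close>.\<close>
    obtain r :: nat where r: "(LINT x|K. \<Psi> (real r) x) < \<delta>"
      using order_tendstoD(2)[OF tight' \<delta>(1)] by (auto simp: eventually_sequentially)
    obtain q where q: "trig_polynomial (\<lambda>x. complex_of_real (q x))" "continuous_on UNIV q"
      "\<And>x. \<bar>q x\<bar> \<le> B + \<delta>" "\<And>x. (\<And>i. \<bar>x $ i\<bar> \<le> real r + 1) \<Longrightarrow> \<bar>g x - q x\<bar> \<le> \<delta>"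
      using continuous_approx_trig[OF g, of "real r + 1" \<delta>] \<delta> by auto
    have [measurable]: "q \<in> borel_measurable borel" by (rule borel_measurable_continuous_onI) fact
    have qi: "integrable (N n) q" "integrable K q" for n
      using q(3) by (auto intro!: N.integrable_const_bound[where B = "B + \<delta>"] K.integrable_const_bound[where B = "B + \<delta>"])
    have "(\<lambda>n. LINT x|N n. complex_of_real (q x)) \<longlonglongrightarrow> (LINT x|K. complex_of_real (q x))"
      by (rule trig_polynomial_integral_tendsto) fact+
    then have q_lim: "(\<lambda>n. LINT x|N n. q x) \<longlonglongrightarrow> (LINT x|K. q x)"
      by (simp add: tendsto_of_real_iff)
    have pt: "\<bar>g x - q x\<bar> \<le> \<delta> + D * \<Psi> r x" for x
    proof (cases "\<forall>i. \<bar>x $ i\<bar> \<le> real r + 1")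
      case True
      moreover have "0 \<le> \<Psi> r x" using \<psi> unfolding \<Psi>_def by (intro sum_nonneg) auto
      ultimately show ?thesis using q(4)[of x] D(1) by (smt (verit) mult_nonneg_nonneg)
    next
      case False
      then obtain i where "real r + 1 < \<bar>x $ i\<bar>" by (auto simp: not_le)
      then have "1 = \<psi> r (x $ i)" by (simp add: \<psi>_def)
      also have "\<dots> \<le> \<Psi> r x" unfolding \<Psi>_def using \<psi> by (intro member_le_sum) auto
      finally have *: "D * 1 \<le> D * \<Psi> r x" using D(1) by (intro mult_left_mono) auto
      have "\<bar>g x - q x\<bar> \<le> \<delta> + D * 1" using g(2)[of x] q(3)[of x] D(2) by simp
      also have "\<dots> \<le> \<delta> + D * \<Psi> r x" using * by (rule add_left_mono)
      finally show ?thesis .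
    qed
    have est: "\<bar>(LINT x|R. g x) - (LINT x|R. q x)\<bar> \<le> \<delta> + D * (LINT x|R. \<Psi> r x)"
      if "prob_space R" and [simp]: "integrable R g" "integrable R q" "integrable R (\<Psi> r)" for R
    proof -
      interpret prob_space R by fact
      have "\<bar>(LINT x|R. g x) - (LINT x|R. q x)\<bar> = \<bar>LINT x|R. g x - q x\<bar>" by simp
      also have "\<dots> \<le> (LINT x|R. \<bar>g x - q x\<bar>)" by (rule integral_abs_bound)
      also have "\<dots> \<le> (LINT x|R. \<delta> + D * \<Psi> r x)"
        by (intro integral_mono) (auto simp: pt)
      finally show ?thesis by (simp add: prob_space)
    qed
    have "\<forall>\<^sub>F n in sequentially. (LINT x|N n. \<Psi> r x) < \<delta>" using order_tendstoD(2)[OF marginal' r] .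
    moreover have "\<forall>\<^sub>F n in sequentially. \<bar>(LINT x|N n. q x) - (LINT x|K. q x)\<bar> < \<delta>"
      using tendstoD[OF q_lim \<delta>(1)] by (simp add: dist_real_def)
    ultimately have "\<forall>\<^sub>F n in sequentially. norm ((LINT x|N n. g x) - (LINT x|K. g x)) < \<epsilon>"
    proof eventually_elim
      case (elim n)
      have "D * (LINT x|N n. \<Psi> r x) \<le> D * \<delta>"
        "D * (LINT x|K. \<Psi> r x) \<le> D * \<delta>"
        using elim r D(1) by (auto intro!: mult_left_mono)
      then have "\<bar>(LINT x|N n. g x) - (LINT x|N n. q x)\<bar> \<le> \<delta> + D * \<delta>"
        "\<bar>(LINT x|K. g x) - (LINT x|K. q x)\<bar> \<le> \<delta> + D * \<delta>"
        using est[OF N(1) gi(1) qi(1) \<Psi>i(1), of n] est[OF K(1) gi(2) qi(2) \<Psi>i(2)] by simp_all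
      then have "\<bar>(LINT x|N n. g x) - (LINT x|K. g x)\<bar> < 2 * (\<delta> + D * \<delta>) + \<delta>"
        using elim(2) by (rule triangle)
      also have "\<dots> \<le> \<delta> * (4 * B + 6)" using \<delta> by (simp add: D algebra_simps)
      also have "\<dots> \<le> \<epsilon>" by (rule \<delta>)
      finally show ?case by simp
    qed
    then show "\<exists>no. \<forall>n\<ge>no. norm ((LINT x|N n. g x) - (LINT x|K. g x)) < \<epsilon>"
      by (simp add: eventually_sequentially)
  qed
qed

text \<open>As \<open>G\<close> stays between positive bounds, \<open>G x * ln (G x)\<close> is
  bounded and continuous, and the logarithm is continuous at the limiting mean. The lemma serves
  twice: from the walks to \<open>\<mu> t\<close>, where \<open>C n\<close> carries the factor due
  to laziness, and from \<open>\<mu> t\<close> to \<open>\<sigma>\<close>, where it is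
  constant.\<close>

lemma ent_le_limit:
  fixes N :: "nat \<Rightarrow> (real ^ 'n) measure" and G R :: "real ^ 'n \<Rightarrow> real"
  assumes N: "\<And>n. prob_space (N n)" "\<And>n. sets (N n) = sets borel" and K: "prob_space K" "sets K = sets borel"
    and lim: "\<And>\<xi>. (\<lambda>n. char_fun (N n) \<xi>) \<longlonglongrightarrow> char_fun K \<xi>"
    and G: "continuous_on UNIV G" "0 < c" "\<And>x. c \<le> G x" "\<And>x. G x \<le> B"
    and R: "continuous_on UNIV R" "\<And>x. \<bar>R x\<bar> \<le> B'"
    and le: "\<And>n. ent (N n) G \<le> C n * (LINT x|N n. R x)" and C: "C \<longlonglongrightarrow> C'"
  shows "ent K G \<le> C' * (LINT x|K. R x)"
proof (rule LIMSEQ_le)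
  note tends = char_fun_tendsto_imp_integral_tendsto[OF N K lim]
  show "(\<lambda>n. C n * (LINT x|N n. R x)) \<longlonglongrightarrow> C' * (LINT x|K. R x)"
    by (intro tendsto_mult C tends[OF R])
  interpret prob_space K by fact
  note K(2)[measurable_cong]
  have [measurable]: "G \<in> borel_measurable borel" by (rule borel_measurable_continuous_onI) (rule G)
  have ab: "\<bar>G x\<bar> \<le> B" for x using G(2) G(3)[of x] G(4)[of x] by linarith
  have mean: "0 < (LINT x|K. G x)"
  proof -
    have "integrable K G" by (rule integrable_const_bound[where B = B]) (auto simp: ab)
    then have "c \<le> (LINT x|K. G x)" using G(3) by (intro integral_ge_const) auto
    then show ?thesis using G(2) by linarith
  qed
  have limG: "(\<lambda>n. LINT x|N n. G x) \<longlonglongrightarrow> (LINT x|K. G x)" by (rule tends[OF G(1) ab])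
  have nz: "G x \<noteq> 0" for x using G(2) G(3)[of x] by linarith
  have "(\<lambda>n. LINT x|N n. G x * ln (G x)) \<longlonglongrightarrow> (LINT x|K. G x * ln (G x))"
  proof (rule tends)
    show "continuous_on UNIV (\<lambda>x. G x * ln (G x))"
      using nz by (intro continuous_intros G) auto
    fix x
    have "ln c \<le> ln (G x)" "ln (G x) \<le> ln B" using G(2) G(3)[of x] G(4)[of x] by auto
    then have "\<bar>ln (G x)\<bar> \<le> \<bar>ln c\<bar> + \<bar>ln B\<bar>" by linarith
    then show "\<bar>G x * ln (G x)\<bar> \<le> B * (\<bar>ln c\<bar> + \<bar>ln B\<bar>)"
      using ab[of x] unfolding abs_mult by (intro mult_mono) auto
  qed
  then show "(\<lambda>n. ent (N n) G) \<longlonglongrightarrow> ent K G"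
    unfolding ent_def using mean limG by (intro tendsto_diff tendsto_mult tendsto_ln) auto
  show "\<exists>N'. \<forall>n\<ge>N'. ent (N n) G \<le> C n * (LINT x|N n. R x)" using le by blast
qed

section \<open>Eigenvectors of the adjoint generator\<close>

text \<open>A general \<open>x\<close> lies outside the domain of the generator, but its integrated
  orbit lies inside. An eigenvector of the adjoint can therefore be tested against integrated orbits
  of arbitrary points.\<close>

lemma C0_semigroup_integral_in_generator:
  fixes T :: "real \<Rightarrow> 'a::{real_inner, banach} \<Rightarrow>\<^sub>L 'a"
  assumes T: "C0_semigroup T" and "0 \<le> t"
  shows "(integral {0..t} (\<lambda>s. T s x), T t x - x) \<in> generator T"
proof -
  have T0: "T 0 x = x" for x using T by (simp add: C0_semigroup_def)
  have TT: "T (r + s) x = T r (T s x)" if "0 \<le> r" "0 \<le> s" for r s x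
    using T that by (simp add: C0_semigroup_def)
  define u where "u = (\<lambda>s. T s x)"
  have cont: "continuous_on {a..b} u" if "0 \<le> a" for a b
    using T that unfolding C0_semigroup_def u_def by (auto intro: continuous_on_subset)
  define \<Phi> where "\<Phi> = (\<lambda>r. integral {0..r} u)"
  \<comment> \<open>By the semigroup law, T r - 1 sends the integral over [0, t] to the integral
    over [t, t + r] minus that over [0, r], which is \<open>\<Psi> r - \<Psi> 0\<close>. The claim
    is thus the right derivative of \<open>\<Psi>\<close> at 0.\<close>
  define \<Psi> where "\<Psi> = (\<lambda>r. \<Phi> (t + r) - \<Phi> r)"
  have int: "u integrable_on {a..b}" if "0 \<le> a" for a b
    by (intro integrable_continuous_interval cont that)
  have d\<Phi>: "(\<Phi> has_vector_derivative u r) (at r within {0..t + 1})" if "r \<in> {0..t + 1}" for r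
    unfolding \<Phi>_def by (rule integral_has_vector_derivative) (use cont that in auto)
  have sub: "(\<lambda>r. t + r) ` {0..1} \<subseteq> {0..t + 1}" using \<open>0 \<le> t\<close> by auto
  have "((\<Phi> \<circ> (\<lambda>r. t + r)) has_vector_derivative (1 *\<^sub>R u t)) (at 0 within {0..1})"
  proof (rule vector_diff_chain_within)
    show "((+) t has_vector_derivative 1) (at 0 within {0..1})"
      by (auto intro!: derivative_eq_intros)
    show "(\<Phi> has_vector_derivative u t) (at (t + 0) within (+) t ` {0..1})"
      using has_vector_derivative_within_subset[OF d\<Phi> sub] \<open>0 \<le> t\<close> by simp
  qed
  moreover have "(\<Phi> has_vector_derivative u 0) (at 0 within {0..1})"
    by (rule has_vector_derivative_within_subset[OF d\<Phi>]) (use \<open>0 \<le> t\<close> in auto)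
  ultimately have "(\<Psi> has_vector_derivative (u t - u 0)) (at 0 within {0..1})"
    unfolding \<Psi>_def by (auto intro!: derivative_eq_intros simp: o_def)
  then have "((\<lambda>r. (1 / norm (r - 0)) *\<^sub>R (\<Psi> r - (\<Psi> 0 + (r - 0) *\<^sub>R (u t - u 0)))) \<longlongrightarrow> 0) (at 0 within {0..1})"
    unfolding has_vector_derivative_def has_derivative_within by blast
  then have "((\<lambda>r. (1 / norm (r - 0)) *\<^sub>R (\<Psi> r - (\<Psi> 0 + (r - 0) *\<^sub>R (u t - u 0)))) \<longlongrightarrow> 0) (at_right 0)"
    by (simp add: at_within_Icc_at_right)
  then have lim: "((\<lambda>r. (1 / norm (r - 0)) *\<^sub>R (\<Psi> r - (\<Psi> 0 + (r - 0) *\<^sub>R (u t - u 0))) + (u t - u 0)) \<longlongrightarrow> 0 + (u t - u 0)) (at_right 0)"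
    by (intro tendsto_add tendsto_const)
  have "(T r (\<Phi> t) - \<Phi> t) /\<^sub>R r
    = (1 / norm (r - 0)) *\<^sub>R (\<Psi> r - (\<Psi> 0 + (r - 0) *\<^sub>R (u t - u 0))) + (u t - u 0)" if "0 < r" for r
  proof -
    have "T r (\<Phi> t) = integral {0..t} (\<lambda>s. T r (u s))"
      unfolding \<Phi>_def using integral_linear[OF int[of 0 t] blinfun.bounded_linear_right[of "T r"]]
      by (simp add: o_def)
    also have "\<dots> = integral {0..t} (\<lambda>s. u (r + s))"
      by (rule integral_cong) (use TT that in \<open>auto simp: u_def\<close>)
    also have "\<dots> = integral {r..t + r} u"
      using integral_shift_Icc_real[of 0 t u r] by (simp add: o_def)
    also have "\<dots> = \<Phi> (t + r) - \<Phi> r"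
      unfolding \<Phi>_def using Henstock_Kurzweil_Integration.integral_combine[of 0 r "t + r" u] int[of 0] that \<open>0 \<le> t\<close>
      by (simp add: algebra_simps)
    finally have "T r (\<Phi> t) - \<Phi> t = \<Psi> r - \<Psi> 0"
      by (simp add: \<Psi>_def \<Phi>_def)
    then show ?thesis using that by (simp add: scaleR_diff_right divide_inverse_commute scaleR_add_right)
  qed
  then have "\<forall>\<^sub>F r in at_right 0. (T r (\<Phi> t) - \<Phi> t) /\<^sub>R r
    = (1 / norm (r - 0)) *\<^sub>R (\<Psi> r - (\<Psi> 0 + (r - 0) *\<^sub>R (u t - u 0))) + (u t - u 0)"
    using eventually_at_right_less by (rule eventually_mono[rotated])
  with lim have "((\<lambda>r. (T r (\<Phi> t) - \<Phi> t) /\<^sub>R r) \<longlongrightarrow> u t - u 0) (at_right 0)"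
    by (subst tendsto_cong) (assumption, simp)
  then show ?thesis by (simp add: generator_def u_def \<Phi>_def T0)
qed

text \<open>The coordinate of an orbit along \<open>e\<close> solves the integrated form of y' = c
  y, for every starting point.\<close>

lemma eigenvector_adjoint_generator:
  fixes T :: "real \<Rightarrow> 'a::{real_inner, banach} \<Rightarrow>\<^sub>L 'a"
  assumes T: "C0_semigroup T" and "eigenvector (graph_adjoint (generator T)) e"
  obtains c where "\<And>t x. 0 \<le> t \<Longrightarrow> T t x \<bullet> e = exp (c * t) * (x \<bullet> e)"
proof -
  obtain c where c: "(e, c *\<^sub>R e) \<in> graph_adjoint (generator T)"
    using assms(2) by (auto simp: eigenvector_def)
  show thesis
  proof
    fix t :: real and x assume "0 \<le> t"
    define u where "u = (\<lambda>s. T s x)"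
    have cont: "continuous_on {0..b} u" for b
      using T unfolding C0_semigroup_def u_def by (auto intro: continuous_on_subset)
    have eq: "u s \<bullet> e = x \<bullet> e + c * integral {0..s} (\<lambda>r. u r \<bullet> e)" if "0 \<le> s" for s
    proof -
      have "(u s - x) \<bullet> e = integral {0..s} u \<bullet> (c *\<^sub>R e)"
        using c C0_semigroup_integral_in_generator[OF T that, of x]
        by (auto simp: graph_adjoint_def u_def)
      also have "integral {0..s} u \<bullet> (c *\<^sub>R e) = c * integral {0..s} (\<lambda>r. u r \<bullet> e)"
        using integral_linear[OF integrable_continuous_interval[OF cont] bounded_linear_inner_left[of e]]
        by (simp add: o_def)
      finally show ?thesis by (simp add: inner_diff_left)
    qed
    \<comment> \<open>Orbits of general points need not be differentiable, so the derivative of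
      \<open>z\<close> is computed from the right-hand side of \<open>eq\<close>, where only an
      integral has to be differentiated.\<close>
    define z where "z = (\<lambda>s. exp (- c * s) * (u s \<bullet> e))"
    have "\<exists>k. \<forall>s\<in>{0..t}. z s = k"
    proof (rule has_field_derivative_zero_constant)
      fix s assume s: "s \<in> {0..t}"
      have "((\<lambda>r. integral {0..r} (\<lambda>r. u r \<bullet> e)) has_vector_derivative u s \<bullet> e) (at s within {0..t})"
        by (rule integral_has_vector_derivative[OF _ s]) (intro continuous_intros cont)
      then have d: "((\<lambda>r. integral {0..r} (\<lambda>r. u r \<bullet> e)) has_field_derivative u s \<bullet> e) (at s within {0..t})"
        by (simp add: has_real_derivative_iff_has_vector_derivative)
      have "((\<lambda>r. exp (- c * r) * (x \<bullet> e + c * integral {0..r} (\<lambda>r. u r \<bullet> e))) has_field_derivative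
         exp (- c * s) * (c * (u s \<bullet> e)) + (exp (- c * s) * - c) * (x \<bullet> e + c * integral {0..s} (\<lambda>r. u r \<bullet> e))) (at s within {0..t})"
        by (auto intro!: derivative_eq_intros d simp: algebra_simps)
      also have "exp (- c * s) * (c * (u s \<bullet> e)) + (exp (- c * s) * - c) * (x \<bullet> e + c * integral {0..s} (\<lambda>r. u r \<bullet> e)) = 0"
        using eq[of s] s by (simp add: algebra_simps)
      finally show "(z has_field_derivative 0) (at s within {0..t})"
        by (rule has_field_derivative_transform_within[OF _ zero_less_one s]) (use eq in \<open>auto simp: z_def\<close>)
    qed simp
    then have "z t = z 0" using \<open>0 \<le> t\<close> by fastforce
    moreover have "u 0 = x" using T by (simp add: u_def C0_semigroup_def)
    ultimately have "exp (c * t) * (exp (- (c * t)) * (u t \<bullet> e)) = exp (c * t) * (x \<bullet> e)" by (simp add: z_def)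
    then show "T t x \<bullet> e = exp (c * t) * (x \<bullet> e)"
      by (simp add: u_def mult.assoc[symmetric] exp_minus)
  qed
qed

text \<open>The vectors on which the adjoint is defined form a closed subspace, so that no Riesz
  representation theorem is needed when it is defined on a total set.\<close>

lemma adjoint_total_set:
  fixes S :: "'a::{real_inner, banach} \<Rightarrow>\<^sub>L 'a"
  assumes E: "closure (span E) = UNIV" and ex: "\<And>e. e \<in> E \<Longrightarrow> \<exists>z. \<forall>x. S x \<bullet> e = x \<bullet> z"
  shows "x \<bullet> adjoint S y = S x \<bullet> y"
proof -
  define V where "V = {y. \<exists>z. \<forall>x. S x \<bullet> y = x \<bullet> z}"
  have "subspace V" unfolding subspace_def
  proof safe
    show "0 \<in> V" by (auto simp: V_def intro: exI[of _ 0])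
  next
    fix a b assume "a \<in> V" "b \<in> V"
    then show "a + b \<in> V" by (auto simp: V_def inner_add_right) (metis inner_add_right)
  next
    fix c :: real and a assume "a \<in> V"
    then show "c *\<^sub>R a \<in> V" by (auto simp: V_def) (metis inner_scaleR_right)
  qed
  then have span: "span E \<subseteq> V" using ex by (intro span_minimal) (auto simp: V_def)
  have "\<exists>z. \<forall>x. S x \<bullet> y = x \<bullet> z" for y
  proof -
    have "y \<in> closure (span E)" using E by simp
    then obtain Y where Y: "\<And>n. Y n \<in> span E" "Y \<longlonglongrightarrow> y"
      unfolding closure_sequential by blast
    then have "\<forall>n. \<exists>z. \<forall>x. S x \<bullet> Y n = x \<bullet> z" using span by (auto simp: V_def)
    then obtain Z where Z: "\<And>n x. S x \<bullet> Y n = x \<bullet> Z n" by metis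
    \<comment> \<open>Testing the difference against itself gives its squared norm. So
      \<open>Z\<close> is Cauchy, and its limit represents \<open>y\<close>.\<close>
    have bd: "norm (Z m - Z n) \<le> norm S * norm (Y m - Y n)" for m n
    proof -
      have "norm (Z m - Z n) * norm (Z m - Z n) = (Z m - Z n) \<bullet> (Z m - Z n)"
        by (simp add: dot_square_norm power2_eq_square)
      also have "\<dots> = S (Z m - Z n) \<bullet> (Y m - Y n)"
        by (simp add: inner_diff_right[of "Z m - Z n"] inner_diff_right[of "S (Z m - Z n)"] Z)
      also have "\<dots> \<le> norm (S (Z m - Z n)) * norm (Y m - Y n)" by (rule norm_cauchy_schwarz)
      also have "\<dots> \<le> (norm S * norm (Z m - Z n)) * norm (Y m - Y n)"
        by (intro mult_right_mono norm_blinfun) auto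
      finally have "norm (Z m - Z n) * norm (Z m - Z n) \<le> norm (Z m - Z n) * (norm S * norm (Y m - Y n))"
        by (simp add: mult_ac)
      then show ?thesis by (cases "Z m = Z n") auto
    qed
    have "Cauchy Z"
    proof (rule metric_CauchyI)
      fix r :: real assume "0 < r"
      have S1: "0 < norm S + 1" using norm_ge_zero[of S] by linarith
      then have "0 < r / (norm S + 1)" using \<open>0 < r\<close> by simp
      then obtain M where M: "\<And>m n. M \<le> m \<Longrightarrow> M \<le> n \<Longrightarrow> dist (Y m) (Y n) < r / (norm S + 1)"
        using metric_CauchyD[OF LIMSEQ_imp_Cauchy[OF Y(2)]] by blast
      show "\<exists>M. \<forall>m\<ge>M. \<forall>n\<ge>M. dist (Z m) (Z n) < r"
      proof (intro exI allI impI)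
        fix m n assume "M \<le> m" "M \<le> n"
        from M[OF this] have *: "(norm S + 1) * norm (Y m - Y n) < r"
          using S1 by (simp add: dist_norm pos_less_divide_eq mult.commute)
        have "norm (Z m - Z n) \<le> (norm S + 1) * norm (Y m - Y n)"
          using add_mono[OF bd[of m n] norm_ge_zero[of "Y m - Y n"]] by (simp add: distrib_right)
        with * show "dist (Z m) (Z n) < r" by (simp add: dist_norm)
      qed
    qed
    then obtain z where z: "Z \<longlonglongrightarrow> z" using Cauchy_convergent_iff convergent_def by blast
    have "S x \<bullet> y = x \<bullet> z" for x
    proof (rule LIMSEQ_unique)
      show "(\<lambda>n. S x \<bullet> Y n) \<longlonglongrightarrow> S x \<bullet> y" by (intro tendsto_intros Y)
      show "(\<lambda>n. S x \<bullet> Y n) \<longlonglongrightarrow> x \<bullet> z" unfolding Z by (intro tendsto_intros z)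
    qed
    then show ?thesis by blast
  qed
  \<comment> \<open>\<open>adjoint\<close> is defined by choice; its defining equation becomes
    available once some adjoint map on the whole space is exhibited.\<close>
  then obtain S' where "\<forall>x y. S x \<bullet> y = x \<bullet> S' y" by metis
  with adjoint_unique[OF this] show ?thesis by simp
qed

section \<open>Lazy random walks\<close>

text \<open>With l the mass of \<open>L\<close>, this is the point mass at 0 plus (L - l times that
  point mass) / r, written as a coin toss followed by an independent jump. When l = 0 the jump
  cannot be normalised and \<open>return borel 0\<close> fills its place; the coin then never allows
  a jump.\<close>

definition lazy_law :: "'b::euclidean_space measure \<Rightarrow> real \<Rightarrow> 'b measure" where
  "lazy_law L r = distr (measure_pmf (bernoulli_pmf (measure L UNIV / r)) \<Otimes>\<^sub>M
     (if measure L UNIV = 0 then return borel 0 else density L (\<lambda>_. ennreal (1 / measure L UNIV))))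
     borel (\<lambda>(b, y). if b then y else 0)"

lemma lazy_law:
  fixes L :: "'b::euclidean_space measure"
  assumes L: "finite_measure L" "sets L = sets borel" and r: "0 < r" "measure L UNIV \<le> r"
  shows prob_space_lazy_law: "prob_space (lazy_law L r)"
    and sets_lazy_law: "sets (lazy_law L r) = sets borel"
    and integral_lazy_law: "\<And>(\<phi> :: 'b \<Rightarrow> 'c::{banach, second_countable_topology}) B.
      \<phi> \<in> borel_measurable borel \<Longrightarrow> (\<And>x. norm (\<phi> x) \<le> B) \<Longrightarrow>
      (LINT y|lazy_law L r. \<phi> y) = \<phi> 0 + (1 / r) *\<^sub>R (LINT y|L. \<phi> y - \<phi> 0)"
proof -
  interpret L: finite_measure L by fact
  note L(2)[measurable_cong]
  have sp: "space L = UNIV" using sets_eq_imp_space_eq[OF L(2)] by simp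
  define l where "l = measure L UNIV"
  define q where "q = l / r"
  define Y where "Y = (if l = 0 then return borel 0 else density L (\<lambda>_. ennreal (1 / l)))"
  have l: "0 \<le> l" by (simp add: l_def)
  have q: "0 \<le> q" "q \<le> 1" using r l by (auto simp: q_def l_def)
  have eq: "lazy_law L r = distr (measure_pmf (bernoulli_pmf q) \<Otimes>\<^sub>M Y) borel (\<lambda>(b, y). if b then y else 0)"
    by (simp add: lazy_law_def q_def l_def Y_def)
  have sY [measurable_cong]: "sets Y = sets borel" by (simp add: Y_def L)
  have "prob_space Y"
  proof (cases "l = 0")
    case False
    have "emeasure L UNIV = ennreal l" by (simp add: l_def L.emeasure_eq_measure)
    moreover have "ennreal (1 / l) * ennreal l = 1" using False l by (simp flip: ennreal_mult)
    ultimately show ?thesis using False sp L(2)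
      by (intro prob_spaceI) (simp add: Y_def emeasure_density_const)
  qed (simp add: Y_def prob_space_return)
  then interpret Y: prob_space Y .
  interpret b: prob_space "measure_pmf (bernoulli_pmf q)" by (rule prob_space_measure_pmf)
  interpret pair_prob_space "measure_pmf (bernoulli_pmf q)" Y ..
  have meas [measurable]: "(\<lambda>(b, y). if b then y else 0) \<in> measure_pmf (bernoulli_pmf q) \<Otimes>\<^sub>M Y \<rightarrow>\<^sub>M borel"
    by measurable
  show "prob_space (lazy_law L r)" unfolding eq by (rule prob_space_distr) (rule meas)
  show "sets (lazy_law L r) = sets borel" by (simp add: eq)
  show "(LINT y|lazy_law L r. \<phi> y) = \<phi> 0 + (1 / r) *\<^sub>R (LINT y|L. \<phi> y - \<phi> 0)"
    if [measurable]: "\<phi> \<in> borel_measurable borel" and B: "\<And>x. norm (\<phi> x) \<le> B"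
    for \<phi> :: "'b \<Rightarrow> 'c" and B
  proof -
    have iL [simp]: "integrable L \<phi>" by (rule L.integrable_const_bound[where B = B]) (auto simp: B)
    have "integrable (measure_pmf (bernoulli_pmf q) \<Otimes>\<^sub>M Y) (\<lambda>(b, y). \<phi> (if b then y else 0))"
      by (rule integrable_const_bound[where B = B]) (auto simp: B)
    from integral_fst'[OF this]
    have "(LINT y|lazy_law L r. \<phi> y) = (LINT b|measure_pmf (bernoulli_pmf q). LINT y|Y. \<phi> (if b then y else 0))"
      unfolding eq by (subst integral_distr) (simp_all add: split_beta' cong: if_cong)
    also have "\<dots> = q *\<^sub>R (LINT y|Y. \<phi> y) + (1 - q) *\<^sub>R \<phi> 0"
      by (subst integral_measure_pmf[of UNIV]) (use q in \<open>auto simp: UNIV_bool Y.prob_space\<close>)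
    also have "\<dots> = \<phi> 0 + (1 / r) *\<^sub>R (LINT y|L. \<phi> y - \<phi> 0)"
    proof (cases "l = 0")
      case True
      then have "emeasure L (space L) = 0" by (simp add: sp l_def L.emeasure_eq_measure)
      then have "AE x in L. False" by (intro AE_I[where N = "space L"]) auto
      then have "(LINT y|L. \<phi> y - \<phi> 0) = (LINT y|L. 0)"
        by (intro integral_cong_AE) auto
      then show ?thesis using True by (simp add: q_def)
    next
      case False
      then have 1: "(LINT y|Y. \<phi> y) = (1 / l) *\<^sub>R (LINT y|L. \<phi> y)"
        using l by (simp add: Y_def integral_density)
      have 2: "(LINT y|L. \<phi> y - \<phi> 0) = (LINT y|L. \<phi> y) - l *\<^sub>R \<phi> 0"
        by (simp add: sp l_def)
      show ?thesis unfolding 1 2 q_def using False r by (simp add: algebra_simps)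
    qed
    finally show ?thesis .
  qed
qed

text \<open>Only an inequality, because \<open>L\<close> may itself charge 0: nonzero jumps can have
  zero projection.\<close>

lemma lazy_law_zero:
  fixes L :: "'b::euclidean_space measure"
  assumes L: "finite_measure L" "sets L = sets borel" and r: "0 < r" "measure L UNIV \<le> r"
  shows "1 - measure L UNIV / r \<le> measure (lazy_law L r) {0}"
proof -
  interpret L: finite_measure L by fact
  have sp: "space L = UNIV" using sets_eq_imp_space_eq[OF L(2)] by simp
  have "measure (lazy_law L r) {0} = (LINT y|lazy_law L r. indicator {0} y)"
    using sets_eq_imp_space_eq[of "lazy_law L r" borel] by (simp add: sets_lazy_law[OF assms])
  also have "\<dots> = 1 + (1 / r) *\<^sub>R (LINT y|L. indicator {0} y - 1)"
    by (subst integral_lazy_law[OF assms, where B = 1]) (auto simp: indicator_def)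
  also have "\<dots> = 1 + (measure L {0} - measure L UNIV) / r"
  proof -
    have "integrable L (indicator {0} :: 'b \<Rightarrow> real)"
      using L(2) by (intro L.integrable_const_bound[where B = 1]) (auto simp: indicator_def)
    then show ?thesis by (simp add: sp)
  qed
  also have "\<dots> \<ge> 1 - measure L UNIV / r" using r by (simp add: diff_divide_distrib)
  finally show "1 - measure L UNIV / r \<le> measure (lazy_law L r) {0}" by simp
qed

section \<open>Levy measures\<close>

lemma levy_measure_integrable:
  assumes "levy_measure M"
  shows "integrable M (\<lambda>x. min 1 ((norm x)\<^sup>2))"
proof (rule integrableI_nonneg)
  have [measurable_cong]: "sets M = sets borel" using assms by (simp add: levy_measure_def)
  show "(\<lambda>x. min 1 ((norm x)\<^sup>2)) \<in> borel_measurable M" by measurable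
qed (use assms in \<open>auto simp: levy_measure_def\<close>)

lemma levy_measure_integrable_bound:
  fixes f :: "'a::real_normed_vector \<Rightarrow> 'c::{banach, second_countable_topology}"
  assumes "levy_measure M" "f \<in> borel_measurable M" "\<And>x. norm (f x) \<le> C * min 1 ((norm x)\<^sup>2)"
  shows "integrable M f"
proof (rule Bochner_Integration.integrable_bound)
  show "integrable M (\<lambda>x. C * min 1 ((norm x)\<^sup>2))"
    by (intro integrable_mult_right levy_measure_integrable assms)
  show "AE x in M. norm (f x) \<le> norm (C * min 1 ((norm x)\<^sup>2))"
    using assms(3) by (intro AE_I2) (metis abs_ge_self order_trans real_norm_def)
qed fact

lemma levy_measure_outside_ball:
  assumes "levy_measure M" "0 < r"
  shows "emeasure M {x. r < norm x} < \<infinity>"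
proof -
  have sets [measurable_cong]: "sets M = sets borel" using assms by (simp add: levy_measure_def)
  have sp: "space M = UNIV" using sets_eq_imp_space_eq[OF sets] by simp
  have "emeasure M {x. r < norm x} = (\<integral>\<^sup>+x. indicator {x. r < norm x} x \<partial>M)"
    by (subst nn_integral_indicator) (auto simp: sets)
  also have "\<dots> \<le> (\<integral>\<^sup>+x. ennreal (1 / min 1 (r\<^sup>2)) * ennreal (min 1 ((norm x)\<^sup>2)) \<partial>M)"
  proof (rule nn_integral_mono)
    fix x :: 'a
    show "(indicator {x. r < norm x} x :: ennreal) \<le> ennreal (1 / min 1 (r\<^sup>2)) * ennreal (min 1 ((norm x)\<^sup>2))"
    proof (cases "r < norm x")
      case True
      then have "r\<^sup>2 \<le> (norm x)\<^sup>2" using assms(2) by (intro power_mono) auto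
      then have "min 1 (r\<^sup>2) \<le> min 1 ((norm x)\<^sup>2)" by (intro min.mono) auto
      moreover have "0 < min 1 (r\<^sup>2)" using assms(2) by simp
      ultimately have "1 \<le> 1 / min 1 (r\<^sup>2) * min 1 ((norm x)\<^sup>2)"
        by (simp only: times_divide_eq_left mult_1 pos_le_divide_eq)
      then have "ennreal 1 \<le> ennreal (1 / min 1 (r\<^sup>2) * min 1 ((norm x)\<^sup>2))" by (rule ennreal_leI)
      also have "\<dots> = ennreal (1 / min 1 (r\<^sup>2)) * ennreal (min 1 ((norm x)\<^sup>2))"
        by (rule ennreal_mult) auto
      finally show ?thesis using True by simp
    qed simp
  qed
  also have "\<dots> = ennreal (1 / min 1 (r\<^sup>2)) * (\<integral>\<^sup>+x. ennreal (min 1 ((norm x)\<^sup>2)) \<partial>M)"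
    by (rule nn_integral_cmult) measurable
  also have "\<dots> < \<infinity>" using assms by (auto simp: levy_measure_def ennreal_mult_less_top)
  finally show ?thesis .
qed

lemma levy_measure_sigma_finite:
  assumes "levy_measure M"
  shows "sigma_finite_measure M"
proof
  have sets: "sets M = sets borel" and 0: "emeasure M {0} = 0" using assms by (auto simp: levy_measure_def)
  have sp: "space M = UNIV" using sets_eq_imp_space_eq[OF sets] by simp
  define A where "A = insert {0} (range (\<lambda>k::nat. {x::'a. 1 / real (Suc k) < norm x}))"
  have "x \<in> \<Union> A" for x :: 'a
  proof (cases "x = 0")
    case False
    then obtain k where "1 / real (Suc k) < norm x"
      using nat_approx_posE[of "norm x"] by (auto simp: inverse_eq_divide)
    then show ?thesis by (auto simp: A_def)
  qed (auto simp: A_def)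
  then show "\<exists>A. countable A \<and> A \<subseteq> sets M \<and> \<Union> A = space M \<and> (\<forall>a\<in>A. emeasure M a \<noteq> \<infinity>)"
    using levy_measure_outside_ball[OF assms, of "1 / real (Suc _)"] 0
    by (intro exI[of _ A]) (auto simp: A_def sets sp less_top)
qed

lemma levy_measure_integral_norm_le:
  fixes f :: "'a::real_normed_vector \<Rightarrow> 'c::{banach, second_countable_topology}"
  assumes "levy_measure M" "f \<in> borel_measurable M" "\<And>x. norm (f x) \<le> C * min 1 ((norm x)\<^sup>2)"
  shows "norm (LINT x|M. f x) \<le> C * (LINT x|M. min 1 ((norm x)\<^sup>2))"
proof -
  have "norm (LINT x|M. f x) \<le> (LINT x|M. norm (f x))" by (rule integral_norm_bound)
  also have "\<dots> \<le> (LINT x|M. C * min 1 ((norm x)\<^sup>2))"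
    using levy_measure_integrable_bound[OF assms] levy_measure_integrable[OF assms(1)] assms(3)
    by (intro integral_mono integrable_norm integrable_mult_right) auto
  finally show ?thesis by simp
qed

text \<open>The truncation is a separate argument because the norm of the original jump decides it,
  while \<open>u\<close> depends on the projected jump only.\<close>

definition levy_integrand :: "real \<Rightarrow> bool \<Rightarrow> complex" where
  "levy_integrand u small = exp (\<i> * complex_of_real u) - 1 - \<i> * complex_of_real (u * of_bool small)"

text \<open>The summand \<open>K\<^sup>2\<close> comes from the second-order Taylor bound for small
  jumps, the summand 2 from the trivial bound for large ones.\<close>

lemma levy_integrand_bound:
  assumes "\<bar>u\<bar> \<le> K * norm x"
  shows "norm (levy_integrand u (norm x < 1)) \<le> (K\<^sup>2 + 2) * min 1 ((norm x)\<^sup>2)"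
proof (cases "norm x < 1")
  case True
  have "norm (levy_integrand u True) = norm (exp (\<i> * complex_of_real u) - (\<Sum>k\<le>1. (\<i> * complex_of_real u) ^ k / fact k))"
    by (simp add: levy_integrand_def diff_diff_eq)
  also have "\<dots> \<le> \<bar>u\<bar> ^ Suc 1 / fact (Suc 1)" by (rule iexp_approx1)
  also have "\<dots> \<le> \<bar>u\<bar>\<^sup>2" by (simp add: power2_eq_square)
  also have "\<dots> \<le> (K * norm x)\<^sup>2" by (rule power_mono[OF assms]) simp
  also have "\<dots> \<le> (K\<^sup>2 + 2) * (norm x)\<^sup>2" by (simp add: power_mult_distrib mult_right_mono)
  also have "(norm x)\<^sup>2 = min 1 ((norm x)\<^sup>2)"
    using True power_le_one[of "norm x" 2] by (simp add: min_absorb2)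
  finally show ?thesis using True by simp
next
  case False
  have "norm (levy_integrand u False) \<le> norm (exp (\<i> * complex_of_real u)) + norm (1 :: complex)"
    unfolding levy_integrand_def using norm_triangle_ineq4[of "exp (\<i> * complex_of_real u)" 1] by (simp del: norm_exp_i_times)
  then have "norm (levy_integrand u False) \<le> 2" by simp
  also have "\<dots> \<le> K\<^sup>2 + 2" by simp
  finally show ?thesis using False by (simp add: min_absorb1 not_less)
qed

text \<open>A density instead of a restriction keeps the carrier and the sigma-algebra of
  \<open>M\<close>; \<open>Suc k\<close> keeps the radius positive and finite from the
  start.\<close>

definition outside_ball :: "'a::real_normed_vector measure \<Rightarrow> nat \<Rightarrow> 'a measure" where
  "outside_ball M k = density M (indicator {x. 1 / real (Suc k) < norm x})"

lemma outside_ball: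
  fixes M :: "'a::{real_normed_vector, second_countable_topology} measure"
  assumes M: "levy_measure M"
  shows finite_measure_outside_ball: "finite_measure (outside_ball M k)"
    and sets_outside_ball: "sets (outside_ball M k) = sets borel"
    and integral_outside_ball: "\<And>f :: 'a \<Rightarrow> 'c::{banach, second_countable_topology}. f \<in> borel_measurable borel \<Longrightarrow>
      (LINT x|outside_ball M k. f x) = (LINT x|M. indicator {x. 1 / real (Suc k) < norm x} x *\<^sub>R f x)"
    and nn_integral_outside_ball_le: "\<And>g. g \<in> borel_measurable borel \<Longrightarrow>
      (\<integral>\<^sup>+x. g x \<partial>outside_ball M k) \<le> (\<integral>\<^sup>+x. g x \<partial>M)"
proof -
  have sets [measurable_cong]: "sets M = sets borel" using M by (simp add: levy_measure_def)
  have sp: "space M = UNIV" using sets_eq_imp_space_eq[OF sets] by simp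
  let ?A = "{x::'a. 1 / real (Suc k) < norm x}"
  have A [measurable]: "?A \<in> sets borel" by measurable
  show "finite_measure (outside_ball M k)"
  proof
    have "emeasure (outside_ball M k) UNIV = emeasure M ?A"
      unfolding outside_ball_def by (subst emeasure_density) (auto simp: sets nn_integral_indicator intro!: borel_measurable_indicator)
    moreover have "emeasure M ?A < \<infinity>" by (rule levy_measure_outside_ball[OF M]) simp
    ultimately show "emeasure (outside_ball M k) (space (outside_ball M k)) \<noteq> \<infinity>"
      by (simp add: outside_ball_def sp)
  qed
  show "sets (outside_ball M k) = sets borel" by (simp add: outside_ball_def sets)
  show "(LINT x|outside_ball M k. f x) = (LINT x|M. indicator ?A x *\<^sub>R f x)"
    if [measurable]: "f \<in> borel_measurable borel" for f :: "'a \<Rightarrow> 'c"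
  proof -
    have "(indicator ?A :: 'a \<Rightarrow> ennreal) = (\<lambda>x. ennreal (indicator ?A x))" by (auto simp: indicator_def)
    then show ?thesis unfolding outside_ball_def by (simp add: integral_density)
  qed
  show "(\<integral>\<^sup>+x. g x \<partial>outside_ball M k) \<le> (\<integral>\<^sup>+x. g x \<partial>M)"
    if [measurable]: "g \<in> borel_measurable borel" for g
    unfolding outside_ball_def
    by (subst nn_integral_density) (auto intro!: nn_integral_mono simp: indicator_def)
qed

text \<open>\<open>K\<close> only serves to make the truncated characteristics integrable. In the application
  \<open>\<tau>\<close> is Lebesgue measure on \<open>{0..t}\<close>, and \<open>Z s\<close> is \<open>T s\<close> followed by a coordinate projection.\<close>

locale levy_image =
  fixes \<tau> :: "'s measure" and M :: "'a::{real_normed_vector, second_countable_topology} measure"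
    and Z :: "'s \<Rightarrow> 'a \<Rightarrow> real ^ 'n" and K :: real
  assumes finite: "finite_measure \<tau>" and levy: "levy_measure M"
    and Z_measurable [measurable]: "case_prod Z \<in> borel_measurable (\<tau> \<Otimes>\<^sub>M borel)"
    and Z_bound: "\<And>s x. s \<in> space \<tau> \<Longrightarrow> norm (Z s x) \<le> K * norm x"
begin

definition jump_law :: "nat \<Rightarrow> (real ^ 'n) measure" where
  "jump_law k = distr (\<tau> \<Otimes>\<^sub>M outside_ball M k) borel (case_prod Z)"

text \<open>The mean displacement due to those jumps that are small before projection. It may
  diverge with \<open>k\<close>; only its combination with \<open>jump_law\<close> has a
  limit.\<close>

definition compensator :: "nat \<Rightarrow> real ^ 'n" where
  "compensator k = (LINT p|(\<tau> \<Otimes>\<^sub>M outside_ball M k). of_bool (norm (snd p) < 1) *\<^sub>R Z (fst p) (snd p))"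

lemma sets_M [measurable_cong]: "sets M = sets borel"
  using levy by (simp add: levy_measure_def)

lemmas sets_outside [measurable_cong] = sets_outside_ball[OF levy]

lemma finite_measure_pair: "finite_measure (\<tau> \<Otimes>\<^sub>M outside_ball M k)"
  by (intro finite_measure_pair_measure finite finite_measure_outside_ball levy)

lemma sets_jump_law [measurable_cong]: "sets (jump_law k) = sets borel"
  by (simp add: jump_law_def)

lemma finite_measure_jump_law: "finite_measure (jump_law k)"
  unfolding jump_law_def
  by (rule finite_measure.finite_measure_distr[OF finite_measure_pair]) measurable

lemma Z_inner_bound: "s \<in> space \<tau> \<Longrightarrow> \<bar>Z s x \<bullet> \<eta>\<bar> \<le> (K * norm \<eta>) * norm x"
proof -
  assume "s \<in> space \<tau>"
  have "\<bar>Z s x \<bullet> \<eta>\<bar> \<le> norm (Z s x) * norm \<eta>" by (rule Cauchy_Schwarz_ineq2)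
  also have "\<dots> \<le> (K * norm x) * norm \<eta>" by (intro mult_right_mono Z_bound \<open>s \<in> space \<tau>\<close>) simp
  finally show ?thesis by (simp add: mult_ac)
qed

lemma integrand_measurable [measurable]:
  "(\<lambda>p. levy_integrand (Z (fst p) (snd p) \<bullet> \<eta>) (norm (snd p) < 1)) \<in> borel_measurable (\<tau> \<Otimes>\<^sub>M borel)"
  unfolding levy_integrand_def of_bool_def by measurable

lemma integrand_measurable' [measurable]:
  assumes "s \<in> space \<tau>"
  shows "(\<lambda>x. levy_integrand (Z s x \<bullet> \<eta>) (norm x < 1)) \<in> borel_measurable borel"
  using measurable_compose[OF measurable_Pair1'[OF assms] integrand_measurable] by simp

lemma integrand_bound:
  "s \<in> space \<tau> \<Longrightarrow> norm (levy_integrand (Z s x \<bullet> \<eta>) (norm x < 1)) \<le> ((K * norm \<eta>)\<^sup>2 + 2) * min 1 ((norm x)\<^sup>2)"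
  by (rule levy_integrand_bound) (rule Z_inner_bound)

lemma levy_integral_measurable [measurable]:
  "(\<lambda>s. LINT x|M. levy_integrand (Z s x \<bullet> \<eta>) (norm x < 1)) \<in> borel_measurable \<tau>"
proof -
  interpret M: sigma_finite_measure M by (rule levy_measure_sigma_finite) (rule levy)
  show ?thesis using integrand_measurable by measurable
qed

lemma levy_integral_norm_le:
  assumes "s \<in> space \<tau>"
  shows "norm (LINT x|M. levy_integrand (Z s x \<bullet> \<eta>) (norm x < 1))
    \<le> ((K * norm \<eta>)\<^sup>2 + 2) * (LINT x|M. min 1 ((norm x)\<^sup>2))"
  by (rule levy_measure_integral_norm_le[OF levy _ integrand_bound[OF assms]])
    (use integrand_measurable'[OF assms] in \<open>simp cong: measurable_cong_sets add: sets_M\<close>)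

lemma levy_integral_integrable: "integrable \<tau> (\<lambda>s. LINT x|M. levy_integrand (Z s x \<bullet> \<eta>) (norm x < 1))"
  using levy_integral_norm_le
  by (intro finite_measure.integrable_const_bound[OF finite]) auto

text \<open>Dominated convergence in the jump and then in time: the bound of
  \<open>levy_integrand\<close> depends neither on \<open>k\<close> nor on \<open>s\<close>.\<close>

lemma truncated_levy_integral_tendsto:
  "(\<lambda>k. LINT s|\<tau>. LINT x|outside_ball M k. levy_integrand (Z s x \<bullet> \<eta>) (norm x < 1))
     \<longlonglongrightarrow> (LINT s|\<tau>. LINT x|M. levy_integrand (Z s x \<bullet> \<eta>) (norm x < 1))"
proof -
  interpret finite_measure \<tau> by (rule finite)
  let ?F = "\<lambda>s x. levy_integrand (Z s x \<bullet> \<eta>) (norm x < 1)"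
  let ?A = "\<lambda>k. {x::'a. 1 / real (Suc k) < norm x}"
  let ?C = "(K * norm \<eta>)\<^sup>2 + 2"
  have bd: "norm (indicator (?A k) x *\<^sub>R ?F s x) \<le> ?C * min 1 ((norm x)\<^sup>2)" if "s \<in> space \<tau>" for k s x
    using integrand_bound[OF that, of x \<eta>] by (auto simp: indicator_def)
  have eq: "(LINT x|outside_ball M k. ?F s x) = (LINT x|M. indicator (?A k) x *\<^sub>R ?F s x)" if "s \<in> space \<tau>" for s k
    by (rule integral_outside_ball[OF levy integrand_measurable'[OF that]])
  have ptw: "(\<lambda>k. indicator (?A k) x *\<^sub>R ?F s x) \<longlonglongrightarrow> ?F s x" if s: "s \<in> space \<tau>" for s x
  \<comment> \<open>No truncation contains 0, but the integrand vanishes there by its own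
    bound.\<close>
  proof (cases "x = 0")
    case True
    then show ?thesis using integrand_bound[OF s, of 0 \<eta>] by simp
  next
    case False
    then obtain k0 where k0: "1 / real (Suc k0) < norm x"
      using nat_approx_posE[of "norm x"] by (auto simp: inverse_eq_divide)
    show ?thesis
    proof (rule tendsto_eventually, rule eventually_sequentiallyI)
      fix k assume "k0 \<le> k"
      then have "1 / real (Suc k) \<le> 1 / real (Suc k0)" by (intro divide_left_mono) auto
      then show "indicator (?A k) x *\<^sub>R ?F s x = ?F s x" using k0 by (simp add: indicator_def)
    qed
  qed
  have inner_lim: "(\<lambda>k. LINT x|M. indicator (?A k) x *\<^sub>R ?F s x) \<longlonglongrightarrow> (LINT x|M. ?F s x)" if s: "s \<in> space \<tau>" for s
  proof (rule integral_dominated_convergence)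
    show "integrable M (\<lambda>x. ?C * min 1 ((norm x)\<^sup>2))"
      by (intro integrable_mult_right levy_measure_integrable levy)
    note integrand_measurable'[OF s, measurable]
    show "?F s \<in> borel_measurable M" by measurable
    show "(\<lambda>x. indicator (?A k) x *\<^sub>R ?F s x) \<in> borel_measurable M" for k by measurable
  qed (use bd[OF s] ptw[OF s] in auto)
  show ?thesis
  proof (rule integral_dominated_convergence)
    show "integrable \<tau> (\<lambda>s. ?C * (LINT x|M. min 1 ((norm x)\<^sup>2)))" by simp
    show "AE s in \<tau>. (\<lambda>k. LINT x|outside_ball M k. ?F s x) \<longlonglongrightarrow> (LINT x|M. ?F s x)"
      using inner_lim by (auto simp: eq)
    show "AE s in \<tau>. norm (LINT x|outside_ball M k. ?F s x) \<le> ?C * (LINT x|M. min 1 ((norm x)\<^sup>2))" for k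
    proof (rule AE_I2)
      fix s assume s: "s \<in> space \<tau>"
      note integrand_measurable'[OF s, measurable]
      have "norm (LINT x|M. indicator (?A k) x *\<^sub>R ?F s x) \<le> ?C * (LINT x|M. min 1 ((norm x)\<^sup>2))"
        by (rule levy_measure_integral_norm_le[OF levy _ bd[OF s]]) measurable
      then show "norm (LINT x|outside_ball M k. ?F s x) \<le> ?C * (LINT x|M. min 1 ((norm x)\<^sup>2))"
        by (simp add: eq[OF s])
    qed
    fix k
    interpret Mk: finite_measure "outside_ball M k" by (rule finite_measure_outside_ball) (rule levy)
    show "(\<lambda>s. LINT x|outside_ball M k. ?F s x) \<in> borel_measurable \<tau>" using integrand_measurable by measurable
  qed measurable
qed

text \<open>After truncation the exponential part and the compensating part are integrable
  separately, so the compensator can be moved from the integrand into the shift.\<close>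

lemma jump_exponent:
  "\<i> * complex_of_real ((a - compensator k) \<bullet> \<eta>) + (LINT y|jump_law k. exp (\<i> * complex_of_real (y \<bullet> \<eta>)) - 1)
    = \<i> * complex_of_real (a \<bullet> \<eta>) + (LINT s|\<tau>. LINT x|outside_ball M k. levy_integrand (Z s x \<bullet> \<eta>) (norm x < 1))"
proof -
  interpret t: finite_measure \<tau> by (rule finite)
  interpret Mk: finite_measure "outside_ball M k" by (rule finite_measure_outside_ball) (rule levy)
  interpret P: pair_sigma_finite \<tau> "outside_ball M k" ..
  interpret N: finite_measure "\<tau> \<Otimes>\<^sub>M outside_ball M k" by (rule finite_measure_pair)
  let ?N = "\<tau> \<Otimes>\<^sub>M outside_ball M k"
  let ?e = "\<lambda>p. exp (\<i> * complex_of_real (Z (fst p) (snd p) \<bullet> \<eta>)) - 1"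
  let ?c = "\<lambda>p. of_bool (norm (snd p) < 1) *\<^sub>R Z (fst p) (snd p)"
  have in_space: "fst p \<in> space \<tau>" if "p \<in> space ?N" for p using that by (auto simp: space_pair_measure)
  have ie: "integrable ?N ?e"
  proof (rule N.integrable_const_bound[where B = 2])
    have "norm (exp (\<i> * complex_of_real u) - 1) \<le> 2" for u
      using norm_triangle_ineq4[of "exp (\<i> * complex_of_real u)" 1] by simp
    then show "AE p in ?N. norm (?e p) \<le> 2" by simp
  qed measurable
  have ic: "integrable ?N ?c"
  proof (rule N.integrable_const_bound[where B = "\<bar>K\<bar>"])
    show "AE p in ?N. norm (?c p) \<le> \<bar>K\<bar>"
    proof (rule AE_I2)
      fix p assume "p \<in> space ?N"
      then have "norm (Z (fst p) (snd p)) \<le> K * norm (snd p)" by (intro Z_bound in_space)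
      moreover have "K * norm (snd p) \<le> \<bar>K\<bar> * 1" if "norm (snd p) < 1"
        using that by (intro order_trans[OF mult_right_mono[OF abs_ge_self] mult_left_mono]) auto
      ultimately show "norm (?c p) \<le> \<bar>K\<bar>" by auto
    qed
  qed measurable
  have ici: "integrable ?N (\<lambda>p. ?c p \<bullet> \<eta>)" using ic by (rule integrable_inner_left)
  have "(LINT s|\<tau>. LINT x|outside_ball M k. levy_integrand (Z s x \<bullet> \<eta>) (norm x < 1))
    = (LINT p|?N. levy_integrand (Z (fst p) (snd p) \<bullet> \<eta>) (norm (snd p) < 1))"
  proof -
    have "integrable ?N (\<lambda>(s, x). levy_integrand (Z s x \<bullet> \<eta>) (norm x < 1))"
    proof (rule N.integrable_const_bound[where B = "(K * norm \<eta>)\<^sup>2 + 2"])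
      have "norm (levy_integrand (Z s x \<bullet> \<eta>) (norm x < 1)) \<le> (K * norm \<eta>)\<^sup>2 + 2" if "s \<in> space \<tau>" for s x
        by (rule order_trans[OF integrand_bound[OF that] mult_right_le_one_le]) auto
      then show "AE p in ?N. norm (case p of (s, x) \<Rightarrow> levy_integrand (Z s x \<bullet> \<eta>) (norm x < 1)) \<le> (K * norm \<eta>)\<^sup>2 + 2"
        by (auto simp: space_pair_measure)
    qed (use integrand_measurable in \<open>simp add: split_beta' sets_outside cong: measurable_cong_sets\<close>)
    from P.integral_fst'[OF this] show ?thesis by (simp add: split_beta')
  qed
  also have "\<dots> = (LINT p|?N. ?e p - \<i> * complex_of_real (?c p \<bullet> \<eta>))"
    by (intro Bochner_Integration.integral_cong) (auto simp: levy_integrand_def)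
  also have "\<dots> = (LINT p|?N. ?e p) - \<i> * complex_of_real (compensator k \<bullet> \<eta>)"
    using ie ici ic unfolding compensator_def
    by (subst Bochner_Integration.integral_diff) (auto simp del: inner_scaleR_left)
  also have "(LINT p|?N. ?e p) = (LINT y|jump_law k. exp (\<i> * complex_of_real (y \<bullet> \<eta>)) - 1)"
    unfolding jump_law_def by (subst integral_distr) (auto simp: split_beta')
  finally show ?thesis by (simp add: inner_diff_left algebra_simps)
qed

end

text \<open>The limit is made quantitative because \<open>a\<close> will vary along with
  \<open>m\<close>, at the scale of a mass that may tend to infinity. Both 1 + a / m and exp (a / m)
  have norm at most 1, so their m-th powers differ by at most m times their difference. The 3 bounds
  \<open>exp 1\<close>.\<close>

lemma norm_power_minus_exp_le:
  fixes a :: complex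
  assumes m: "0 < m" "norm a \<le> real m" and a: "Re a \<le> 0" "norm (1 + a / of_nat m) \<le> 1"
  shows "norm ((1 + a / of_nat m) ^ m - exp a) \<le> 3 * (norm a)\<^sup>2 / m"
proof -
  let ?z = "a / of_nat m"
  have z: "norm ?z = norm a / m" using m by (simp add: norm_divide)
  have "norm (exp ?z - (\<Sum>k\<le>1. ?z ^ k / fact k)) \<le> exp \<bar>Re ?z\<bar> * norm ?z ^ Suc 1 / fact 1"
    by (rule Taylor_exp)
  then have "norm (exp ?z - (1 + ?z)) \<le> exp \<bar>Re ?z\<bar> * (norm ?z)\<^sup>2" by (simp add: power2_eq_square)
  also have "\<dots> \<le> 3 * (norm ?z)\<^sup>2"
  proof (rule mult_right_mono)
    have "\<bar>Re ?z\<bar> \<le> norm ?z" by (rule abs_Re_le_cmod)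
    also have "\<dots> \<le> 1" unfolding z using m by simp
    finally have "exp \<bar>Re ?z\<bar> \<le> exp 1" by simp
    also have "\<dots> \<le> 3" by (rule exp_le)
    finally show "exp \<bar>Re ?z\<bar> \<le> 3" .
  qed simp
  finally have 1: "norm (1 + ?z - exp ?z) \<le> 3 * (norm ?z)\<^sup>2" by (simp add: norm_minus_commute)
  have "norm ((1 + ?z) ^ m - exp ?z ^ m) \<le> m * norm (1 + ?z - exp ?z)"
    using a m by (intro norm_power_diff) (auto simp: divide_nonpos_pos)
  also have "\<dots> \<le> m * (3 * (norm ?z)\<^sup>2)" using 1 by (intro mult_left_mono) auto
  also have "\<dots> = 3 * (norm a)\<^sup>2 / m" unfolding z using m by (simp add: power2_eq_square field_simps)
  also have "exp ?z ^ m = exp a" using m by (simp flip: exp_of_nat_mult)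
  finally show ?thesis .
qed

section \<open>The energy integral of a Lipschitz function against a Levy measure\<close>

context
  fixes M :: "'a::{real_normed_vector, second_countable_topology} measure"
    and \<pi> :: "'a \<Rightarrow> 'b::euclidean_space" and G :: "'b \<Rightarrow> real" and K \<Lambda> c B :: real
  assumes levy: "levy_measure M"
    and \<pi> [measurable]: "\<pi> \<in> borel_measurable borel" and \<pi>_bound: "\<And>x. norm (\<pi> x) \<le> K * norm x"
    and G_lip: "\<And>x y. \<bar>G x - G y\<bar> \<le> \<Lambda> * norm (x - y)" and G_bounds: "0 < c" "\<And>x. c \<le> G x" "\<And>x. G x \<le> B"
begin

lemma lipschitz_continuous: "continuous_on UNIV G"
proof (rule lipschitz_on_continuous_on)
  \<comment> \<open>The sign of \<open>\<Lambda>\<close> is not assumed, whereas a Lipschitz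
    constant has to be nonnegative.\<close>
  show "(max 0 \<Lambda>)-lipschitz_on UNIV G"
  proof (rule lipschitz_onI)
    fix x y
    have "\<bar>G x - G y\<bar> \<le> max 0 \<Lambda> * norm (x - y)"
      using G_lip[of x y] by (rule order_trans) (auto intro: mult_right_mono)
    then show "dist (G x) (G y) \<le> max 0 \<Lambda> * dist x y" by (simp add: dist_norm)
  qed simp
qed

text \<open>The Lipschitz estimate handles small jumps and the bounds on \<open>G\<close> large
  ones; the sum of the two constants serves for both. Uniformity in \<open>x\<close> gives
  boundedness of the energy and, by domination, its continuity, both required for the passage to the
  limit.\<close>

lemma levy_energy_integrand_bound:
  "\<bar>(G (x + \<pi> y) - G x)\<^sup>2 / G x\<bar> \<le> (B\<^sup>2 + (\<bar>\<Lambda>\<bar> * K)\<^sup>2) / c * min 1 ((norm y)\<^sup>2)"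
proof -
  have B: "\<bar>G (x + \<pi> y) - G x\<bar> \<le> B"
    using G_bounds(1) G_bounds(2,3)[of x] G_bounds(2,3)[of "x + \<pi> y"] by linarith
  have "\<bar>G (x + \<pi> y) - G x\<bar> \<le> \<bar>\<Lambda>\<bar> * norm (\<pi> y)"
    using G_lip[of "x + \<pi> y" x] by (simp add: order_trans[OF _ mult_right_mono[OF abs_ge_self]])
  also have "\<dots> \<le> \<bar>\<Lambda>\<bar> * (K * norm y)" by (intro mult_left_mono \<pi>_bound) simp
  finally have "\<bar>G (x + \<pi> y) - G x\<bar>\<^sup>2 \<le> (\<bar>\<Lambda>\<bar> * K * norm y)\<^sup>2" by (intro power_mono) (auto simp: mult_ac)
  then have 1: "(G (x + \<pi> y) - G x)\<^sup>2 \<le> (\<bar>\<Lambda>\<bar> * K)\<^sup>2 * (norm y)\<^sup>2" by (simp add: power_mult_distrib)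
  have 2: "(G (x + \<pi> y) - G x)\<^sup>2 \<le> B\<^sup>2" using power_mono[OF B, of 2] by simp
  have "(G (x + \<pi> y) - G x)\<^sup>2 \<le> (B\<^sup>2 + (\<bar>\<Lambda>\<bar> * K)\<^sup>2) * min 1 ((norm y)\<^sup>2)"
  proof (cases "1 \<le> (norm y)\<^sup>2")
    case True
    have "(0::real) \<le> (\<bar>\<Lambda>\<bar> * K)\<^sup>2" by simp
    from add_mono[OF 2 this] True show ?thesis by (simp add: min_absorb1)
  next
    case False
    have "(0::real) \<le> B\<^sup>2 * (norm y)\<^sup>2" by simp
    from add_mono[OF this 1] False show ?thesis by (simp add: min_absorb2 distrib_right)
  qed
  then show ?thesis using G_bounds(1) G_bounds(2)[of x]
    by (auto simp: abs_mult intro!: frac_le mult_nonneg_nonneg add_nonneg_nonneg)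
qed

lemma levy_energy_measurable: "(\<lambda>y. (G (x + \<pi> y) - G x)\<^sup>2 / G x) \<in> borel_measurable M"
proof -
  have [measurable_cong]: "sets M = sets borel" using levy by (simp add: levy_measure_def)
  have [measurable]: "G \<in> borel_measurable borel" by (rule borel_measurable_continuous_onI) (rule lipschitz_continuous)
  show ?thesis by measurable
qed

lemma levy_energy_integrable: "integrable M (\<lambda>y. (G (x + \<pi> y) - G x)\<^sup>2 / G x)"
  by (rule levy_measure_integrable_bound[OF levy levy_energy_measurable levy_energy_integrand_bound[folded real_norm_def]])

lemma levy_energy_bounded:
  "\<bar>LINT y|M. (G (x + \<pi> y) - G x)\<^sup>2 / G x\<bar> \<le> (B\<^sup>2 + (\<bar>\<Lambda>\<bar> * K)\<^sup>2) / c * (LINT x|M. min 1 ((norm x)\<^sup>2))"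
  unfolding real_norm_def[symmetric]
  by (rule levy_measure_integral_norm_le[OF levy levy_energy_measurable levy_energy_integrand_bound[folded real_norm_def]])

lemma levy_energy_continuous: "continuous_on UNIV (\<lambda>x. LINT y|M. (G (x + \<pi> y) - G x)\<^sup>2 / G x)"
  unfolding continuous_on_sequentially
proof (intro ballI allI impI, elim conjE)
  fix X :: "nat \<Rightarrow> 'b" and x assume X: "X \<longlonglongrightarrow> x"
  have G_lim: "(\<lambda>n. G (Y n)) \<longlonglongrightarrow> G y" if "Y \<longlonglongrightarrow> y" for Y :: "nat \<Rightarrow> 'b" and y
    using lipschitz_continuous that by (auto simp: continuous_on_sequentially o_def)
  have "(\<lambda>n. LINT y|M. (G (X n + \<pi> y) - G (X n))\<^sup>2 / G (X n)) \<longlonglongrightarrow> (LINT y|M. (G (x + \<pi> y) - G x)\<^sup>2 / G x)"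
  proof (rule integral_dominated_convergence[where w = "\<lambda>y. (B\<^sup>2 + (\<bar>\<Lambda>\<bar> * K)\<^sup>2) / c * min 1 ((norm y)\<^sup>2)"])
    have "G x \<noteq> 0" using G_bounds(1) G_bounds(2)[of x] by linarith
    then show "AE y in M. (\<lambda>n. (G (X n + \<pi> y) - G (X n))\<^sup>2 / G (X n)) \<longlonglongrightarrow> (G (x + \<pi> y) - G x)\<^sup>2 / G x"
      by (intro AE_I2 tendsto_intros G_lim X)
    show "integrable M (\<lambda>y. (B\<^sup>2 + (\<bar>\<Lambda>\<bar> * K)\<^sup>2) / c * min 1 ((norm y)\<^sup>2))"
      by (intro integrable_mult_right levy_measure_integrable levy)
  qed (use levy_energy_integrand_bound levy_energy_measurable in auto)
  then show "((\<lambda>x. LINT y|M. (G (x + \<pi> y) - G x)\<^sup>2 / G x) \<circ> X) \<longlonglongrightarrow> (LINT y|M. (G (x + \<pi> y) - G x)\<^sup>2 / G x)"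
    by (simp add: o_def)
qed

end

section \<open>Approximation of the projected laws by lazy random walks\<close>

context levy_image begin

abbreviation mass :: "nat \<Rightarrow> real" where "mass k \<equiv> measure (jump_law k) UNIV"

text \<open>Large enough that the probability of moving, \<open>mass k / steps k\<close>, and the
  order of the error in the exponential limit, \<open>(mass k)\<^sup>2 / steps k\<close>, are both
  at most 1 / (k + 1). The summand 1 keeps the number positive when there are no jumps.\<close>

definition steps :: "nat \<Rightarrow> nat" where
  "steps k = nat \<lceil>real (Suc k) * (1 + mass k)\<^sup>2\<rceil>"

definition step_law :: "nat \<Rightarrow> (real ^ 'n) measure" where
  "step_law k = lazy_law (jump_law k) (steps k)"

lemma steps: "real (Suc k) * (1 + mass k)\<^sup>2 \<le> steps k" "0 < steps k" "2 * mass k \<le> steps k"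
  "mass k \<le> steps k" "mass k / steps k \<le> 1 / Suc k" "(mass k)\<^sup>2 / steps k \<le> 1 / Suc k" "mass k / steps k < 1"
proof -
  let ?l = "mass k"
  have l: "0 \<le> ?l" by simp
  show 1: "real (Suc k) * (1 + ?l)\<^sup>2 \<le> steps k" unfolding steps_def by linarith
  have 2: "1 + 2 * ?l + ?l\<^sup>2 \<le> real (Suc k) * (1 + ?l)\<^sup>2"
    using mult_right_mono[of 1 "real (Suc k)" "(1 + ?l)\<^sup>2"] by (simp add: power2_sum)
  have l2: "0 \<le> ?l\<^sup>2" by simp
  show 0: "0 < steps k" using 1 2 l l2 by linarith
  show "2 * ?l \<le> steps k" "?l \<le> steps k" using 1 2 l l2 by linarith+
  have "?l < steps k" using 1 2 l l2 by linarith
  then show "?l / steps k < 1" using 0 by simp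
  have "?l * real (Suc k) \<le> steps k" "?l\<^sup>2 * real (Suc k) \<le> steps k"
  proof -
    have "?l \<le> (1 + ?l)\<^sup>2" "?l\<^sup>2 \<le> (1 + ?l)\<^sup>2" using l l2 by (simp_all add: power2_sum)
    then have "real (Suc k) * ?l \<le> real (Suc k) * (1 + ?l)\<^sup>2" "real (Suc k) * ?l\<^sup>2 \<le> real (Suc k) * (1 + ?l)\<^sup>2"
      by (intro mult_left_mono; simp)+
    from this[THEN order_trans, OF 1]
    show "?l * real (Suc k) \<le> steps k" "?l\<^sup>2 * real (Suc k) \<le> steps k" by (simp_all only: mult.commute)
  qed
  then show "?l / steps k \<le> 1 / Suc k" "?l\<^sup>2 / steps k \<le> 1 / Suc k"
    using 0 by (simp_all add: field_simps)
qed

lemma step_law: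
  shows prob_space_step_law: "prob_space (step_law k)"
    and sets_step_law: "sets (step_law k) = sets borel"
    and step_law_zero: "1 - mass k / steps k \<le> measure (step_law k) {0}"
proof -
  have *: "0 < real (steps k)" "mass k \<le> real (steps k)" using steps[of k] by auto
  note lazy = finite_measure_jump_law sets_jump_law *
  show "prob_space (step_law k)" "sets (step_law k) = sets borel" "1 - mass k / steps k \<le> measure (step_law k) {0}"
    unfolding step_law_def
    by (rule prob_space_lazy_law[OF lazy] sets_lazy_law[OF lazy] lazy_law_zero[OF lazy])+
qed

lemma integral_step_law:
  fixes \<phi> :: "real ^ 'n \<Rightarrow> 'c::{banach, second_countable_topology}"
  assumes "\<phi> \<in> borel_measurable borel" "\<And>x. norm (\<phi> x) \<le> B"
  shows "(LINT y|step_law k. \<phi> y) = \<phi> 0 + (1 / steps k) *\<^sub>R (LINT y|jump_law k. \<phi> y - \<phi> 0)"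
  unfolding step_law_def using steps[of k] assms
  by (intro integral_lazy_law finite_measure_jump_law sets_jump_law) auto

text \<open>The walk is compared with exp (V + A), the compound Poisson law of the same truncation.
  \<open>V\<close> and \<open>A\<close> need not converge separately, but their sum does by
  \<open>jump_exponent\<close>.\<close>

lemma char_fun_walk_tendsto:
  "(\<lambda>k. char_fun (random_walk (step_law k) (a - compensator k) (steps k)) \<eta>) \<longlonglongrightarrow>
    exp (\<i> * complex_of_real (a \<bullet> \<eta>) + (LINT s|\<tau>. LINT x|M. levy_integrand (Z s x \<bullet> \<eta>) (norm x < 1)))"
proof -
  define A where "A = (\<lambda>k. LINT y|jump_law k. exp (\<i> * complex_of_real (y \<bullet> \<eta>)) - 1)"
  define V where "V = (\<lambda>k. \<i> * complex_of_real ((a - compensator k) \<bullet> \<eta>))"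
  have char: "char_fun (step_law k) \<eta> = 1 + A k / of_nat (steps k)" for k
    unfolding char_fun_def A_def
    by (subst integral_step_law[where B = 1]) (auto simp: scaleR_conv_of_real)
  have e2: "norm (exp (\<i> * complex_of_real u) - 1) \<le> 2" for u
    using norm_triangle_ineq4[of "exp (\<i> * complex_of_real u)" 1] by simp
  have A: "norm (A k) \<le> 2 * mass k" "Re (A k) \<le> 0" for k
  proof -
    interpret finite_measure "jump_law k" by (rule finite_measure_jump_law)
    have sp: "space (jump_law k) = UNIV" using sets_eq_imp_space_eq[OF sets_jump_law] by simp
    have i: "integrable (jump_law k) (\<lambda>y. exp (\<i> * complex_of_real (y \<bullet> \<eta>)) - 1)"
      by (rule integrable_const_bound[where B = 2]) (auto simp: e2)
    have "norm (A k) \<le> (LINT y|jump_law k. norm (exp (\<i> * complex_of_real (y \<bullet> \<eta>)) - 1))"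
      unfolding A_def by (rule integral_norm_bound)
    also have "\<dots> \<le> (LINT y|jump_law k. 2)" by (intro integral_mono integrable_norm i) (auto simp: e2)
    finally show "norm (A k) \<le> 2 * mass k" by (simp add: sp mult.commute)
    have "Re (A k) = (LINT y|jump_law k. cos (y \<bullet> \<eta>) - 1)"
      unfolding A_def using i by (simp flip: integral_Re add: Re_exp)
    also have "\<dots> \<le> (LINT y|jump_law k. 0)"
      by (intro integral_mono integrable_const_bound[where B = 2]) (auto intro!: order_trans[OF abs_triangle_ineq4] add_mono[of _ 1 _ 1, simplified])
    finally show "Re (A k) \<le> 0" by simp
  qed
  \<comment> \<open>The 12 is 3 times the square of the 2 in the bound of \<open>A k\<close> by
    twice the mass.\<close>
  have approx: "norm (char_fun (random_walk (step_law k) (a - compensator k) (steps k)) \<eta> - exp (V k + A k)) \<le> 12 * (1 / Suc k)" for k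
  proof -
    have pr: "norm (1 + A k / of_nat (steps k)) \<le> 1"
    proof -
      interpret prob_space "step_law k" by (rule prob_space_step_law)
      have "norm (char_fun (step_law k) \<eta>) \<le> (LINT y|step_law k. norm (exp (\<i> * complex_of_real (y \<bullet> \<eta>))))"
        unfolding char_fun_def by (rule integral_norm_bound)
      then show ?thesis unfolding char by (simp add: prob_space)
    qed
    have "norm (char_fun (random_walk (step_law k) (a - compensator k) (steps k)) \<eta> - exp (V k + A k))
      = norm (exp (V k) * ((1 + A k / of_nat (steps k)) ^ steps k - exp (A k)))"
      unfolding char_fun_random_walk[OF prob_space_step_law sets_step_law] char
      by (simp only: V_def exp_add right_diff_distrib)
    also have "\<dots> = norm ((1 + A k / of_nat (steps k)) ^ steps k - exp (A k))"
      by (simp add: norm_mult V_def)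
    also have "\<dots> \<le> 3 * (norm (A k))\<^sup>2 / steps k"
      using A steps[of k] by (intro norm_power_minus_exp_le pr) (auto intro: order_trans)
    also have "\<dots> \<le> 3 * (2 * mass k)\<^sup>2 / steps k"
      using A by (intro divide_right_mono mult_left_mono power_mono) auto
    also have "\<dots> = 12 * ((mass k)\<^sup>2 / steps k)" by (simp add: power_mult_distrib)
    also have "\<dots> \<le> 12 * (1 / Suc k)" using steps[of k] by (intro mult_left_mono) auto
    finally show ?thesis .
  qed
  have "(\<lambda>k. 12 * (1 / real (Suc k))) \<longlonglongrightarrow> 12 * 0"
    using LIMSEQ_inverse_real_of_nat by (intro tendsto_mult_left) (simp add: inverse_eq_divide)
  then have lim0: "(\<lambda>k. 12 * (1 / real (Suc k))) \<longlonglongrightarrow> 0" by (simp only: mult_zero_right)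
  have "(\<lambda>k. char_fun (random_walk (step_law k) (a - compensator k) (steps k)) \<eta> - exp (V k + A k)) \<longlonglongrightarrow> 0"
    by (rule Lim_null_comparison[OF always_eventually lim0]) (rule allI, rule approx)
  moreover have "(\<lambda>k. exp (V k + A k)) \<longlonglongrightarrow>
    exp (\<i> * complex_of_real (a \<bullet> \<eta>) + (LINT s|\<tau>. LINT x|M. levy_integrand (Z s x \<bullet> \<eta>) (norm x < 1)))"
    unfolding V_def A_def jump_exponent
    by (intro tendsto_exp tendsto_add tendsto_const truncated_levy_integral_tendsto)
  ultimately have "(\<lambda>k. char_fun (random_walk (step_law k) (a - compensator k) (steps k)) \<eta> - exp (V k + A k) + exp (V k + A k)) \<longlonglongrightarrow>
    0 + exp (\<i> * complex_of_real (a \<bullet> \<eta>) + (LINT s|\<tau>. LINT x|M. levy_integrand (Z s x \<bullet> \<eta>) (norm x < 1)))"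
    by (rule tendsto_add)
  then show ?thesis by simp
qed

text \<open>The energy of one step is the jump-law integral divided by the number of steps, so the
  factor counting the steps in \<open>ent_random_walk_le\<close> cancels. The hypothesis
  \<open>dom\<close> then exchanges the jump law for \<open>C\<close> times the projection of
  \<open>M\<close>.\<close>

theorem ent_le_levy_energy:
  assumes P: "prob_space P" "sets P = sets borel"
    and char: "\<And>\<eta>. char_fun P \<eta> = exp (\<i> * complex_of_real (a \<bullet> \<eta>) +
        (LINT s|\<tau>. LINT x|M. levy_integrand (Z s x \<bullet> \<eta>) (norm x < 1)))"
    and \<pi> [measurable]: "\<pi> \<in> borel_measurable borel" and \<pi>_bound: "\<And>x. norm (\<pi> x) \<le> K' * norm x"
    and G_lip: "\<And>x y. \<bar>G x - G y\<bar> \<le> \<Lambda> * norm (x - y)" and G: "0 < c" "\<And>x. c \<le> G x" "\<And>x. G x \<le> B"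
    and dom: "\<And>\<phi> :: real ^ 'n \<Rightarrow> ennreal. \<phi> \<in> borel_measurable borel \<Longrightarrow>
      (\<integral>\<^sup>+s. \<integral>\<^sup>+x. \<phi> (Z s x) \<partial>M \<partial>\<tau>) \<le> ennreal C * (\<integral>\<^sup>+x. \<phi> (\<pi> x) \<partial>M)" and C: "0 \<le> C"
  shows "ent P G \<le> C * (LINT x|P. LINT y|M. (G (x + \<pi> y) - G x)\<^sup>2 / G x)"
proof -
  note G_all = levy \<pi> \<pi>_bound G_lip G
  define R where "R = (\<lambda>x. LINT y|M. (G (x + \<pi> y) - G x)\<^sup>2 / G x)"
  define q where "q = (\<lambda>k. mass k / steps k)"
  define N where "N = (\<lambda>k. random_walk (step_law k) (a - compensator k) (steps k))"
  have G_cont: "continuous_on UNIV G" by (rule lipschitz_continuous[OF G_all])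
  have [measurable]: "G \<in> borel_measurable borel" by (rule borel_measurable_continuous_onI) (rule G_cont)
  have G_bb: "G \<in> bounded_borel"
  proof (rule bounded_borelI[where B = B])
    show "\<bar>G x\<bar> \<le> B" for x using G(1) G(2,3)[of x] by linarith
  qed measurable
  have R_cont: "continuous_on UNIV R" unfolding R_def by (rule levy_energy_continuous[OF G_all])
  have R_bound: "\<bar>R x\<bar> \<le> (B\<^sup>2 + (\<bar>\<Lambda>\<bar> * K')\<^sup>2) / c * (LINT x|M. min 1 ((norm x)\<^sup>2))" for x
    unfolding R_def by (rule levy_energy_bounded[OF G_all])
  have R_bb: "R \<in> bounded_borel"
    using R_bound by (intro bounded_borelI borel_measurable_continuous_onI R_cont)
  have N: "prob_space (N k)" "sets (N k) = sets borel" for k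
    unfolding N_def by (intro prob_space_random_walk prob_space_step_law sets_step_law) simp
  have energy_le: "steps k * walk_energy (step_law k) G x \<le> C * R x" for k x
  proof -
    interpret J: finite_measure "jump_law k" by (rule finite_measure_jump_law)
    interpret Mk: finite_measure "outside_ball M k" by (rule finite_measure_outside_ball) (rule levy)
    define \<phi> where "\<phi> = (\<lambda>y. (G (x + y) - G x)\<^sup>2 / G x)"
    have [measurable]: "\<phi> \<in> borel_measurable borel" unfolding \<phi>_def by measurable
    have \<phi>_bound: "\<bar>\<phi> y\<bar> \<le> B\<^sup>2 / c" for y
      unfolding \<phi>_def by (intro walk_energy_integrand_bound G)
    have \<phi>_nn: "0 \<le> \<phi> y" for y unfolding \<phi>_def using G(1) G(2)[of x] by auto
    have "walk_energy (step_law k) G x = \<phi> 0 + (1 / steps k) *\<^sub>R (LINT y|jump_law k. \<phi> y - \<phi> 0)"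
      unfolding walk_energy_def \<phi>_def[symmetric] using \<phi>_bound by (intro integral_step_law[where B = "B\<^sup>2 / c"]) auto
    \<comment> \<open>Staying put costs no energy, so only the jump law contributes.\<close>
    moreover have "\<phi> 0 = 0" by (simp add: \<phi>_def)
    ultimately have eq: "steps k * walk_energy (step_law k) G x = (LINT y|jump_law k. \<phi> y)"
      using steps[of k] by simp
    have "ennreal (LINT y|jump_law k. \<phi> y) = (\<integral>\<^sup>+y. \<phi> y \<partial>jump_law k)"
      using \<phi>_bound \<phi>_nn
      by (intro nn_integral_eq_integral[symmetric] J.integrable_const_bound[where B = "B\<^sup>2 / c"]) auto
    also have "\<dots> = (\<integral>\<^sup>+p. \<phi> (Z (fst p) (snd p)) \<partial>(\<tau> \<Otimes>\<^sub>M outside_ball M k))"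
      unfolding jump_law_def by (subst nn_integral_distr) (auto simp: split_beta')
    also have "\<dots> = (\<integral>\<^sup>+s. \<integral>\<^sup>+x. \<phi> (Z s x) \<partial>outside_ball M k \<partial>\<tau>)"
      by (subst Mk.nn_integral_fst[symmetric]) auto
    also have "\<dots> \<le> (\<integral>\<^sup>+s. \<integral>\<^sup>+x. \<phi> (Z s x) \<partial>M \<partial>\<tau>)"
    proof (rule nn_integral_mono)
      fix s assume s: "s \<in> space \<tau>"
      have "Z s \<in> borel_measurable borel"
        using measurable_compose[OF measurable_Pair1'[OF s] Z_measurable] by simp
      then have "(\<lambda>x. ennreal (\<phi> (Z s x))) \<in> borel_measurable borel" by measurable
      then show "(\<integral>\<^sup>+x. \<phi> (Z s x) \<partial>outside_ball M k) \<le> (\<integral>\<^sup>+x. \<phi> (Z s x) \<partial>M)"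
        by (rule nn_integral_outside_ball_le[OF levy])
    qed
    also have "\<dots> \<le> ennreal C * (\<integral>\<^sup>+x. \<phi> (\<pi> x) \<partial>M)" by (rule dom) measurable
    also have "(\<integral>\<^sup>+x. \<phi> (\<pi> x) \<partial>M) = ennreal (R x)"
      unfolding R_def \<phi>_def
      using levy_energy_integrable[OF G_all, of x] \<phi>_nn by (intro nn_integral_eq_integral) (auto simp: \<phi>_def)
    also have "ennreal C * ennreal (R x) = ennreal (C * R x)"
      using C by (intro ennreal_mult'[symmetric])
    \<comment> \<open>Comparison in \<open>ennreal\<close> forgets negative values; the second
      alternative is settled below by \<open>0 \<le> R x\<close>.\<close>
    finally have "(LINT y|jump_law k. \<phi> y) \<le> C * R x \<or> (LINT y|jump_law k. \<phi> y) \<le> 0 \<and> C * R x \<le> 0"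
      by (auto simp: ennreal_le_iff2)
    moreover have "0 \<le> R x" unfolding R_def using \<phi>_nn by (intro integral_nonneg_AE) (auto simp: \<phi>_def)
    ultimately show ?thesis using C by (auto simp: eq intro: order_trans)
  qed
  have ent_le: "ent (N k) G \<le> C / (1 - q k)\<^sup>2 * (LINT x|N k. R x)" for k
  proof -
    note integrable_N = bounded_borel_integrable[OF prob_space.finite_measure[OF N(1)] N(2)]
    have "ent (N k) G \<le> steps k / (1 - q k)\<^sup>2 * (LINT x|N k. walk_energy (step_law k) G x)"
      unfolding N_def using steps[of k]
      by (intro ent_random_walk_le[where c = c] prob_space_step_law sets_step_law G_bb G)
         (auto simp: q_def step_law_zero)
    also have "\<dots> = 1 / (1 - q k)\<^sup>2 * (LINT x|N k. steps k * walk_energy (step_law k) G x)" by simp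
    also have "\<dots> \<le> 1 / (1 - q k)\<^sup>2 * (LINT x|N k. C * R x)"
    proof (intro mult_left_mono integral_mono)
      show "integrable (N k) (\<lambda>x. steps k * walk_energy (step_law k) G x)"
        by (rule integrable_mult_right, rule integrable_N, rule bounded_borel_walk_energy)
          (rule prob_space_step_law sets_step_law G_bb G)+
      show "integrable (N k) (\<lambda>x. C * R x)" by (rule integrable_mult_right, rule integrable_N, rule R_bb)
    qed (simp_all add: energy_le)
    finally show ?thesis by simp
  qed
  have "q \<longlonglongrightarrow> 0"
  proof (rule Lim_null_comparison)
    show "\<forall>\<^sub>F k in sequentially. norm (q k) \<le> 1 / Suc k" using steps by (simp add: q_def)
    show "(\<lambda>k. 1 / real (Suc k)) \<longlonglongrightarrow> 0" using LIMSEQ_inverse_real_of_nat by (simp add: inverse_eq_divide)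
  qed
  then have "(\<lambda>k. C / (1 - q k)\<^sup>2) \<longlonglongrightarrow> C / (1 - 0)\<^sup>2" by (intro tendsto_intros) auto
  then have C_lim: "(\<lambda>k. C / (1 - q k)\<^sup>2) \<longlonglongrightarrow> C" by simp
  have "ent P G \<le> C * (LINT x|P. R x)"
  proof (rule ent_le_limit[OF N P _ G_cont G R_cont R_bound ent_le C_lim])
    show "(\<lambda>k. char_fun (N k) \<xi>) \<longlonglongrightarrow> char_fun P \<xi>" for \<xi>
      unfolding N_def char by (rule char_fun_walk_tendsto)
  qed
  then show ?thesis by (simp only: R_def)
qed

end

section \<open>Invariant measures and Mehler semigroups\<close>

text \<open>Invariance tested on a character factors the characteristic function of
  \<open>\<sigma>\<close> into \<open>\<alpha> t\<close> and that of \<open>\<mu> t\<close>. Here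
  \<open>\<alpha> t\<close> averages the character over \<open>T t x\<close> and tends to 1 because
  all orbits tend to 0.\<close>

lemma invariant_char_fun_tendsto:
  fixes T :: "real \<Rightarrow> 'a::{real_inner, banach, second_countable_topology} \<Rightarrow>\<^sub>L 'a"
  assumes \<mu>: "\<And>t. 0 \<le> t \<Longrightarrow> prob_space (\<mu> t)" "\<And>t. 0 \<le> t \<Longrightarrow> sets (\<mu> t) = sets borel"
    and inv: "invariant_measure (mehler_semigroup T \<mu>) \<sigma>"
    and T: "\<And>x. ((\<lambda>t. T t x) \<longlongrightarrow> 0) at_top"
  shows "(\<lambda>n. char_fun (\<mu> (real n)) \<xi>) \<longlonglongrightarrow> char_fun \<sigma> \<xi>"
proof -
  have \<sigma>: "prob_space \<sigma>" and s\<sigma> [measurable_cong]: "sets \<sigma> = sets borel"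
    and inv': "\<And>t f. 0 \<le> t \<Longrightarrow> f \<in> bounded_borel \<Longrightarrow> (LINT x|\<sigma>. mehler_semigroup T \<mu> t f x) = (LINT x|\<sigma>. f x)"
    using inv by (auto simp: invariant_measure_def)
  interpret S: prob_space \<sigma> by fact
  \<comment> \<open>Invariance is stated for real functions, so the character is split into cosine
    and sine.\<close>
  define C where "C = (\<lambda>x::'a. cos (x \<bullet> \<xi>))"
  define D where "D = (\<lambda>x::'a. sin (x \<bullet> \<xi>))"
  have CD: "C \<in> bounded_borel" "D \<in> bounded_borel" unfolding C_def D_def
    by (auto intro!: bounded_borelI[where B = 1])
  have T_measurable [measurable]: "blinfun_apply (T t) \<in> borel_measurable borel" for t
    by (intro borel_measurable_continuous_onI continuous_intros)
  have e: "exp (\<i> * complex_of_real (x \<bullet> \<xi>)) = complex_of_real (C x) + \<i> * complex_of_real (D x)" for x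
    by (simp add: C_def D_def exp_Euler flip: cos_of_real sin_of_real)
  have split: "(LINT x|N. complex_of_real (u x) + \<i> * complex_of_real (v x)) = complex_of_real (LINT x|N. u x) + \<i> * complex_of_real (LINT x|N. v x)"
    if "integrable N u" "integrable N v" for N :: "'a measure" and u v
    using that by simp
  define \<alpha> where "\<alpha> = (\<lambda>t. LINT x|\<sigma>. exp (\<i> * complex_of_real (T t x \<bullet> \<xi>)))"
  have factor: "char_fun \<sigma> \<xi> = \<alpha> t * char_fun (\<mu> t) \<xi>" if t: "0 \<le> t" for t
  proof -
    interpret m: prob_space "\<mu> t" by (rule \<mu>) fact
    note \<mu>(2)[OF t, measurable_cong]
    have P: "mehler_semigroup T \<mu> t g \<in> bounded_borel" "\<And>x. (\<lambda>y. g (T t x + y)) \<in> bounded_borel"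
      if g: "g \<in> bounded_borel" for g
    proof -
      obtain B where [measurable]: "g \<in> borel_measurable borel" and B: "\<And>x. \<bar>g x\<bar> \<le> B"
        using g by (rule bounded_borelE) blast
      show "mehler_semigroup T \<mu> t g \<in> bounded_borel"
        unfolding mehler_semigroup_def
        by (rule bounded_borel_average[OF \<mu>[OF t], where B = B]) (auto simp: B)
      show "(\<lambda>y. g (T t x + y)) \<in> bounded_borel" for x
        by (rule bounded_borel_compose[OF g]) measurable
    qed
    note i\<sigma> = bounded_borel_integrable[OF S.finite_measure_axioms s\<sigma>]
    note i\<mu> = bounded_borel_integrable[OF m.finite_measure_axioms \<mu>(2)[OF t]]
    have "char_fun \<sigma> \<xi> = complex_of_real (LINT x|\<sigma>. C x) + \<i> * complex_of_real (LINT x|\<sigma>. D x)"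
      unfolding char_fun_def e by (intro split i\<sigma> CD)
    also have "\<dots> = complex_of_real (LINT x|\<sigma>. mehler_semigroup T \<mu> t C x)
        + \<i> * complex_of_real (LINT x|\<sigma>. mehler_semigroup T \<mu> t D x)"
      by (simp only: inv'[OF t] CD)
    also have "\<dots> = (LINT x|\<sigma>. complex_of_real (mehler_semigroup T \<mu> t C x) + \<i> * complex_of_real (mehler_semigroup T \<mu> t D x))"
      by (rule split[symmetric]) (intro i\<sigma> P CD)+
    also have "\<dots> = (LINT x|\<sigma>. exp (\<i> * complex_of_real (T t x \<bullet> \<xi>)) * char_fun (\<mu> t) \<xi>)"
    proof (rule Bochner_Integration.integral_cong[OF refl])
      fix x
      have "complex_of_real (mehler_semigroup T \<mu> t C x) + \<i> * complex_of_real (mehler_semigroup T \<mu> t D x)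
        = (LINT y|\<mu> t. exp (\<i> * complex_of_real ((T t x + y) \<bullet> \<xi>)))"
        unfolding mehler_semigroup_def e by (rule split[symmetric]) (intro i\<mu> P CD)+
      also have "\<dots> = exp (\<i> * complex_of_real (T t x \<bullet> \<xi>)) * char_fun (\<mu> t) \<xi>"
        unfolding char_fun_def by (simp add: inner_add_left distrib_left exp_add)
      finally show "complex_of_real (mehler_semigroup T \<mu> t C x) + \<i> * complex_of_real (mehler_semigroup T \<mu> t D x) = \<dots>" .
    qed
    also have "\<dots> = \<alpha> t * char_fun (\<mu> t) \<xi>" by (simp add: \<alpha>_def)
    finally show ?thesis .
  qed
  have "(\<lambda>n. \<alpha> (real n)) \<longlonglongrightarrow> (LINT x|\<sigma>. 1)"
    unfolding \<alpha>_def
  proof (rule integral_dominated_convergence[where w = "\<lambda>_. 1"])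
    show "AE x in \<sigma>. (\<lambda>n. exp (\<i> * complex_of_real (T (real n) x \<bullet> \<xi>))) \<longlonglongrightarrow> 1"
    proof (rule AE_I2)
      fix x
      have "(\<lambda>n. T (real n) x) \<longlonglongrightarrow> 0" by (rule filterlim_compose[OF T filterlim_real_sequentially])
      then have "(\<lambda>n. exp (\<i> * complex_of_real (T (real n) x \<bullet> \<xi>))) \<longlonglongrightarrow> exp (\<i> * complex_of_real (0 \<bullet> \<xi>))"
        by (intro tendsto_intros)
      then show "(\<lambda>n. exp (\<i> * complex_of_real (T (real n) x \<bullet> \<xi>))) \<longlonglongrightarrow> 1" by simp
    qed
  qed auto
  then have lim: "(\<lambda>n. \<alpha> (real n)) \<longlonglongrightarrow> 1" by (simp add: S.prob_space)
  \<comment> \<open>As \<open>\<alpha>\<close> tends to 1, it is eventually nonzero and the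
    factorisation can be solved for the other factor.\<close>
  then have "(\<lambda>n. char_fun \<sigma> \<xi> / \<alpha> (real n)) \<longlonglongrightarrow> char_fun \<sigma> \<xi> / 1" by (intro tendsto_divide tendsto_const) auto
  moreover have "\<forall>\<^sub>F n in sequentially. char_fun \<sigma> \<xi> / \<alpha> (real n) = char_fun (\<mu> (real n)) \<xi>"
  proof -
    have "\<forall>\<^sub>F n in sequentially. \<alpha> (real n) \<noteq> 0" using lim by (rule tendsto_imp_eventually_ne) simp
    then show ?thesis
    proof eventually_elim
      case (elim n)
      then show ?case using factor[of "real n"] by simp
    qed
  qed
  ultimately show ?thesis by (simp add: tendsto_cong)
qed

section \<open>Domination integrated over time, and Lipschitz bounds for powers\<close>

lemma nn_integral_positive_difference_le:
  assumes "positive_difference (scale_measure r M) N" "sets N = sets M" "g \<in> borel_measurable M"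
  shows "(\<integral>\<^sup>+x. g x \<partial>N) \<le> r * (\<integral>\<^sup>+x. g x \<partial>M)"
proof -
  have "N \<le> scale_measure r M"
    using assms by (subst le_measure) (auto simp: positive_difference_def)
  then have "(\<integral>\<^sup>+x. g x \<partial>N) \<le> (\<integral>\<^sup>+x. g x \<partial>scale_measure r M)"
    using assms(2) by (intro nn_integral_mono_measure) auto
  then show ?thesis using assms(3) by (simp add: nn_integral_scale_measure)
qed

text \<open>The integral moves to the completed measure because \<open>h\<close> is only Lebesgue
  measurable. Time 0, where no bound is given, is a null set.\<close>

lemma nn_integral_time_average_le:
  fixes h :: "real \<Rightarrow> real"
  assumes h: "set_integrable lebesgue {0<..} h" and le: "\<And>s. 0 < s \<Longrightarrow> g s \<le> ennreal (h s) * I"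
  shows "(\<integral>\<^sup>+s. g s \<partial>restrict_space lborel {0..t}) \<le> ennreal (LINT t:{0<..}|lebesgue. \<bar>h t\<bar>) * I"
proof -
  have h': "integrable lebesgue (\<lambda>s. indicator {0<..} s * h s)"
    using h by (simp add: set_integrable_def)
  then have i: "integrable lebesgue (\<lambda>s. \<bar>indicator {0<..} s * h s\<bar>)" by (rule integrable_abs)
  have "(\<integral>\<^sup>+s. g s \<partial>restrict_space lborel {0..t}) = (\<integral>\<^sup>+s. g s * indicator {0..t} s \<partial>lebesgue)"
    by (simp add: nn_integral_restrict_space nn_integral_completion)
  also have "\<dots> \<le> (\<integral>\<^sup>+s. ennreal \<bar>indicator {0<..} s * h s\<bar> * I \<partial>lebesgue)"
  proof (rule nn_integral_mono_AE)
    have "AE s in lebesgue. s \<noteq> (0::real)" by (intro AE_completion AE_lborel_singleton)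
    then show "AE s in lebesgue. g s * indicator {0..t} s \<le> ennreal \<bar>indicator {0<..} s * h s\<bar> * I"
    proof eventually_elim
      case (elim s)
      have "g s \<le> ennreal \<bar>h s\<bar> * I" if "0 < s"
        using le[OF that] by (rule order_trans) (intro mult_right_mono ennreal_leI; simp)
      then show ?case using elim by (auto simp: indicator_def)
    qed
  qed
  also have "\<dots> = (\<integral>\<^sup>+s. ennreal \<bar>indicator {0<..} s * h s\<bar> \<partial>lebesgue) * I"
    using i by (intro nn_integral_multc) (auto dest!: borel_measurable_integrable intro: measurable_compose_rev)
  also have "(\<integral>\<^sup>+s. ennreal \<bar>indicator {0<..} s * h s\<bar> \<partial>lebesgue) = ennreal (LINT s|lebesgue. \<bar>indicator {0<..} s * h s\<bar>)"
    by (rule nn_integral_eq_integral[OF i]) auto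
  also have "(LINT s|lebesgue. \<bar>indicator {0<..} s * h s\<bar>) = (LINT t:{0<..}|lebesgue. \<bar>h t\<bar>)"
    unfolding set_lebesgue_integral_def by (intro Bochner_Integration.integral_cong) (auto simp: indicator_def)
  finally show ?thesis .
qed

lemma C2_bounded_lipschitz:
  fixes f :: "'v::real_normed_vector \<Rightarrow> real"
  assumes "f \<in> C2_bounded"
  obtains L where "0 \<le> L" "\<And>x y. \<bar>f x - f y\<bar> \<le> L * norm (x - y)"
proof -
  obtain f' :: "'v \<Rightarrow> 'v \<Rightarrow>\<^sub>L real" where d: "\<And>x. (f has_derivative f' x) (at x)" and "bounded (range f')"
    using assms unfolding C2_bounded_def by blast
  then obtain L where L: "\<And>x. norm (f' x) \<le> L" by (auto simp: bounded_iff)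
  show thesis
  proof
    show "0 \<le> L" using norm_ge_zero L[of 0] by (rule order_trans)
    have "norm (f x - f y) \<le> L * norm (x - y)" for x y
      by (rule differentiable_bound[of UNIV f "\<lambda>x. blinfun_apply (f' x)"])
        (auto intro: d L simp flip: norm_blinfun.rep_eq)
    then show "\<bar>f x - f y\<bar> \<le> L * norm (x - y)" for x y by simp
  qed
qed

text \<open>For \<open>1 \<le> p\<close> the derivative p z^(p - 1) is nondecreasing, hence largest
  at \<open>B\<close>.\<close>

lemma powr_lipschitz:
  fixes a b c B p :: real
  assumes "1 \<le> p" "0 < c" "a \<in> {c..B}" "b \<in> {c..B}"
  shows "\<bar>a powr p - b powr p\<bar> \<le> p * B powr (p - 1) * \<bar>a - b\<bar>"
proof -
  have "norm (a powr p - b powr p) \<le> p * B powr (p - 1) * norm (a - b)"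
  proof (rule field_differentiable_bound[where S = "{c..B}" and f' = "\<lambda>z. p * z powr (p - 1)"])
    fix z assume z: "z \<in> {c..B}"
    show "((\<lambda>z. z powr p) has_field_derivative p * z powr (p - 1)) (at z within {c..B})"
      using z assms by (auto intro!: derivative_eq_intros)
    show "norm (p * z powr (p - 1)) \<le> p * B powr (p - 1)"
      using z assms by (auto simp: abs_mult intro!: mult_left_mono powr_mono2)
  qed (use assms in auto)
  then show ?thesis by simp
qed

theorem theorem4p3:
  fixes T :: "real \<Rightarrow> 'a::{real_inner, banach, second_countable_topology} \<Rightarrow>\<^sub>L 'a"
    and b :: 'a and M \<sigma> :: "'a measure" and \<mu> :: "real \<Rightarrow> 'a measure"
    and d :: enat and e :: "nat \<Rightarrow> 'a" and h :: "real \<Rightarrow> real"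
    and p :: real and f :: "'a \<Rightarrow> real"
  assumes "C0_semigroup T"
    and "levy_measure M"
    and "continuous_map sazonov_topology euclidean (levy_exponent b M)"
    and "mehler_measures T b M \<mu>"
    and "orthonormal_basis d e"
    and "\<And>i. enat i < d \<Longrightarrow> eigenvector (graph_adjoint (generator T)) (e i)"
    and "(\<integral>\<^sup>+x\<in>- ball 0 1. ennreal (norm x) \<partial>M) < \<infinity>"
    and "\<exists>b_inf. ((\<lambda>t. mehler_drift T b M t) \<longlongrightarrow> b_inf) at_top"
    and "(\<integral>\<^sup>+s\<in>{0..}. (\<integral>\<^sup>+x. ennreal (min 1 ((norm (T s x))\<^sup>2)) \<partial>M) \<partial>lborel) < \<infinity>"
    and "\<And>x. ((\<lambda>t. T t x) \<longlongrightarrow> 0) at_top"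
    and "\<And>t. 0 < t \<Longrightarrow> 0 < h t"
    and "set_integrable lebesgue {0<..} h"
    and "\<And>t. 0 < t \<Longrightarrow>
           positive_difference (scale_measure (ennreal (h t)) M) (distr M borel (T t))"
    and "invariant_measure (mehler_semigroup T \<mu>) \<sigma>"
    and "1 \<le> p"
    and "f \<in> cylindrical_C2 TYPE('n::finite) d e"
    and "0 < (INF x. f x)"
  shows "ent \<sigma> (\<lambda>x. f x powr p)
    \<le> (LINT t:{0<..}|lebesgue. \<bar>h t\<bar>)
        * (LINT x|\<sigma>. LINT y|M. \<bar>f (x + y) powr p - f x powr p\<bar>\<^sup>2 / f x powr p)"
proof -
  define C where "C = (LINT t:{0<..}|lebesgue. \<bar>h t\<bar>)"
  have C: "0 \<le> C" unfolding C_def set_lebesgue_integral_def by (intro integral_nonneg_AE) auto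
  have sM [measurable_cong]: "sets M = sets borel" using \<open>levy_measure M\<close> by (simp add: levy_measure_def)
  have spM: "space M = UNIV" using sets_eq_imp_space_eq[OF sM] by simp
  have s\<sigma> [measurable_cong]: "sets \<sigma> = sets borel" and "prob_space \<sigma>"
    using assms(14) by (auto simp: invariant_measure_def)
  then interpret S: prob_space \<sigma> by simp
  have \<mu>: "prob_space (\<mu> t)" "sets (\<mu> t) = sets borel"
    and char_\<mu>: "\<And>\<xi>. char_fun (\<mu> t) \<xi> =
           exp (- (LINT s:{0..t}|lborel. levy_exponent b M (adjoint (blinfun_apply (T s)) \<xi>)))" if "0 \<le> t" for t
    using assms(4) that by (auto simp: mehler_measures_def)
  have T_measurable [measurable]: "blinfun_apply (T t) \<in> borel_measurable borel" for t
    by (intro borel_measurable_continuous_onI continuous_intros)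

  have "\<exists>c. \<forall>t x. 0 \<le> t \<longrightarrow> T t x \<bullet> e i = exp (c * t) * (x \<bullet> e i)" if "enat i < d" for i
    using eigenvector_adjoint_generator[OF assms(1) assms(6)[OF that]] by metis
  then obtain c where c: "\<And>i t x. enat i < d \<Longrightarrow> 0 \<le> t \<Longrightarrow> T t x \<bullet> e i = exp (c i * t) * (x \<bullet> e i)"
    by metis
  \<comment> \<open>\<open>mehler_measures\<close> speaks of adjoints; on an eigenvector from the
    basis the adjoint of \<open>T s\<close> is explicitly a scalar, and the basis is total.\<close>
  have adj: "x \<bullet> adjoint (T s) y = T s x \<bullet> y" if "0 \<le> s" for s x y
  proof (rule adjoint_total_set)
    show "closure (span (e ` {i. enat i < d})) = UNIV" using assms(5) by (simp add: orthonormal_basis_def)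
    fix u assume "u \<in> e ` {i. enat i < d}"
    then obtain i where "u = e i" "enat i < d" by auto
    then show "\<exists>z. \<forall>x. T s x \<bullet> u = x \<bullet> z"
      using c[of i s] that by (intro exI[of _ "exp (c i * s) *\<^sub>R e i"]) simp
  qed

  obtain f0 :: "real ^ 'n \<Rightarrow> real" and k :: "'n \<Rightarrow> nat" where f0: "f0 \<in> C2_bounded"
    and k: "bij_betw k UNIV {..<CARD('n)}" and f: "f = (\<lambda>x. f0 (\<chi> i. x \<bullet> e (k i)))" and nd: "enat CARD('n) \<le> d"
    using assms(16) by (auto simp: cylindrical_C2_def)
  have kd: "enat (k i) < d" for i
  proof -
    have "k i < CARD('n)" using k by (auto simp: bij_betw_def)
    then show ?thesis using nd by (meson enat_ord_simps(2) order_less_le_trans)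
  qed
  define \<pi> :: "'a \<Rightarrow> real ^ 'n" where "\<pi> = (\<lambda>x. \<chi> i. x \<bullet> e (k i))"
  \<comment> \<open>The transpose of \<open>\<pi>\<close>: it carries frequencies of a projected law
    to frequencies of the law itself.\<close>
  define \<xi> :: "real ^ 'n \<Rightarrow> 'a" where "\<xi> = (\<lambda>\<eta>. \<Sum>i\<in>UNIV. \<eta> $ i *\<^sub>R e (k i))"
  \<comment> \<open>The explicit exponentials make \<open>Z\<close> jointly continuous in (s, x),
    negative s included, so joint measurability is immediate. For s \<ge> 0 it agrees with
    \<open>\<pi> (T s x)\<close>.\<close>
  define Z :: "real \<Rightarrow> 'a \<Rightarrow> real ^ 'n" where "Z = (\<lambda>s x. \<chi> i. exp (c (k i) * s) * (x \<bullet> e (k i)))"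
  have \<pi>_add: "\<pi> (x + y) = \<pi> x + \<pi> y" for x y by (simp add: \<pi>_def vec_eq_iff inner_add_left)
  have \<pi>_\<xi>: "x \<bullet> \<xi> \<eta> = \<pi> x \<bullet> \<eta>" for x \<eta>
    by (simp add: \<pi>_def \<xi>_def inner_sum_right inner_vec_def mult.commute)
  have \<pi>_T: "\<pi> (T s x) = Z s x" if "0 \<le> s" for s x
    using that by (simp add: \<pi>_def Z_def c kd)
  have \<pi>_cont: "continuous_on UNIV \<pi>" unfolding \<pi>_def by (intro continuous_intros)
  have \<pi> [measurable]: "\<pi> \<in> borel_measurable borel" by (rule borel_measurable_continuous_onI) (rule \<pi>_cont)
  have norm_e: "norm (e (k i)) = 1" for i
    using assms(5) kd[of i] by (simp add: orthonormal_basis_def norm_eq_sqrt_inner)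
  \<comment> \<open>Orthonormality makes \<open>\<pi>\<close> onto, so the positive lower bound of
    \<open>f\<close> is a lower bound of \<open>f0\<close> on all of \<open>real ^ 'n\<close>, where
    the walks live.\<close>
  have \<pi>_surj: "\<pi> (\<xi> \<eta>) = \<eta>" for \<eta>
  proof -
    have on: "e (k i) \<bullet> e (k j) = (if i = j then 1 else 0)" for i j
      using assms(5) kd[of i] kd[of j] k by (auto simp: orthonormal_basis_def bij_betw_def inj_eq)
    show ?thesis by (simp add: \<pi>_def \<xi>_def vec_eq_iff inner_sum_left on if_distrib sum.delta cong: if_cong)
  qed
  have Z_bound: "norm (Z s x) \<le> (\<Sum>i\<in>UNIV. exp (\<bar>c (k i)\<bar> * t)) * norm x" if "s \<in> {0..t}" for s t x
  proof -
    have "norm (Z s x) \<le> (\<Sum>i\<in>UNIV. norm (Z s x $ i))" unfolding real_norm_def by (rule norm_le_l1_cart)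
    also have "\<dots> \<le> (\<Sum>i\<in>UNIV. exp (\<bar>c (k i)\<bar> * t) * norm x)"
    proof (rule sum_mono)
      fix i
      have "c (k i) * s \<le> \<bar>c (k i)\<bar> * t" using that by (intro mult_mono) auto
      moreover have "\<bar>x \<bullet> e (k i)\<bar> \<le> norm x" using Cauchy_Schwarz_ineq2[of x "e (k i)"] by (simp add: norm_e)
      ultimately show "norm (Z s x $ i) \<le> exp (\<bar>c (k i)\<bar> * t) * norm x"
        by (auto simp: Z_def abs_mult intro!: mult_mono)
    qed
    finally show ?thesis by (simp add: sum_distrib_right)
  qed
  have Z0: "Z 0 = \<pi>" by (simp add: Z_def \<pi>_def)
  \<comment> \<open>The sum is the number of coordinates, kept in the form that
    \<open>Z_bound\<close> yields at time 0.\<close>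
  have \<pi>_bound: "norm (\<pi> x) \<le> (\<Sum>i\<in>(UNIV :: 'n set). exp (\<bar>c (k i)\<bar> * 0)) * norm x" for x
    using Z_bound[of 0 0 x] by (simp add: Z0)
  have Z_borel [measurable]: "case_prod Z \<in> borel_measurable (borel \<Otimes>\<^sub>M borel)"
    unfolding borel_prod Z_def split_beta' by (intro borel_measurable_continuous_onI continuous_intros)

  define c0 where "c0 = (INF x. f x)"
  obtain B0 where B0: "\<And>u. \<bar>f0 u\<bar> \<le> B0" using f0 by (auto simp: C2_bounded_def bounded_iff)
  have c0: "0 < c0" using assms(17) by (simp add: c0_def)
  have f0_ge: "c0 \<le> f0 u" for u
  proof -
    have "bdd_below (range f)"
    proof (rule bdd_belowI2)
      show "- B0 \<le> f x" for x using B0[of "\<chi> i. x \<bullet> e (k i)"] by (simp add: f abs_le_iff)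
    qed
    then have "c0 \<le> f (\<xi> u)" unfolding c0_def by (rule cINF_lower) simp
    also have "f (\<xi> u) = f0 u" using \<pi>_surj[of u] by (simp add: f \<pi>_def)
    finally show ?thesis .
  qed
  have f0_le: "f0 u \<le> B0" for u using B0[of u] by simp
  define G where "G = (\<lambda>u. f0 u powr p)"
  have fG: "f x powr p = G (\<pi> x)" for x by (simp add: f G_def \<pi>_def)
  have G: "0 < c0 powr p" "c0 powr p \<le> G u" "G u \<le> B0 powr p" for u
    unfolding G_def using c0 f0_ge[of u] f0_le[of u] assms(15) by (auto intro!: powr_mono2)
  obtain L where L: "0 \<le> L" "\<And>u v. \<bar>f0 u - f0 v\<bar> \<le> L * norm (u - v)"
    using C2_bounded_lipschitz[OF f0] by blast
  have G_lip: "\<bar>G u - G v\<bar> \<le> p * B0 powr (p - 1) * L * norm (u - v)" for u v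
  proof -
    have "\<bar>G u - G v\<bar> \<le> p * B0 powr (p - 1) * \<bar>f0 u - f0 v\<bar>"
      unfolding G_def using assms(15) c0 f0_ge f0_le by (intro powr_lipschitz[of p c0]) auto
    also have "\<dots> \<le> p * B0 powr (p - 1) * (L * norm (u - v))"
      using assms(15) L by (intro mult_left_mono) auto
    finally show ?thesis by (simp add: mult.assoc)
  qed
  note G_all = assms(2) \<pi> \<pi>_bound G_lip G
  define R where "R = (\<lambda>u. LINT y|M. (G (u + \<pi> y) - G u)\<^sup>2 / G u)"

  have dom: "(\<integral>\<^sup>+s. \<integral>\<^sup>+x. \<phi> (Z s x) \<partial>M \<partial>restrict_space lborel {0..t}) \<le> ennreal C * (\<integral>\<^sup>+x. \<phi> (\<pi> x) \<partial>M)"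
    if [measurable]: "\<phi> \<in> borel_measurable borel" for t and \<phi> :: "real ^ 'n \<Rightarrow> ennreal"
    unfolding C_def
  proof (rule nn_integral_time_average_le[OF assms(12)])
    fix s :: real assume s: "0 < s"
    have "(\<integral>\<^sup>+x. \<phi> (Z s x) \<partial>M) = (\<integral>\<^sup>+x. \<phi> (\<pi> x) \<partial>distr M borel (T s))"
      using s by (subst nn_integral_distr) (auto simp: \<pi>_T)
    also have "\<dots> \<le> ennreal (h s) * (\<integral>\<^sup>+x. \<phi> (\<pi> x) \<partial>M)"
      by (rule nn_integral_positive_difference_le[OF assms(13)[OF s]]) (simp_all add: sM)
    finally show "(\<integral>\<^sup>+x. \<phi> (Z s x) \<partial>M) \<le> ennreal (h s) * (\<integral>\<^sup>+x. \<phi> (\<pi> x) \<partial>M)" .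
  qed

  have char_distr: "char_fun (distr N borel \<pi>) \<eta> = char_fun N (\<xi> \<eta>)" if "sets N = sets borel" for N \<eta>
  proof -
    note that[measurable_cong]
    show ?thesis unfolding char_fun_def \<pi>_\<xi> by (subst integral_distr) auto
  qed
  have step: "ent (distr (\<mu> t) borel \<pi>) G \<le> C * (LINT u|distr (\<mu> t) borel \<pi>. R u)" if t: "0 \<le> t" for t
  proof -
    define \<tau> where "\<tau> = restrict_space lborel {0..t}"
    have sp\<tau>: "space \<tau> = {0..t}" by (simp add: \<tau>_def space_restrict_space)
    have id\<tau> [measurable]: "(\<lambda>s. s) \<in> borel_measurable \<tau>" unfolding \<tau>_def by (rule measurable_restrict_space1) simp
    interpret levy_image \<tau> M Z "\<Sum>i\<in>UNIV. exp (\<bar>c (k i)\<bar> * t)"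
    proof (rule levy_image.intro)
      show "finite_measure \<tau>"
        by (rule finite_measureI) (use t in \<open>simp only: sp\<tau>, simp add: \<tau>_def emeasure_restrict_space\<close>)
      show "case_prod Z \<in> borel_measurable (\<tau> \<Otimes>\<^sub>M borel)"
        using measurable_compose[OF _ Z_borel, of "\<lambda>p. (fst p, snd p)" "\<tau> \<Otimes>\<^sub>M borel"] by (simp add: split_beta')
      show "norm (Z s x) \<le> (\<Sum>i\<in>UNIV. exp (\<bar>c (k i)\<bar> * t)) * norm x" if "s \<in> space \<tau>" for s x
        using that by (intro Z_bound) (simp add: sp\<tau>)
    qed (rule assms(2))
    interpret t: finite_measure \<tau> by (rule finite)
    interpret m: prob_space "\<mu> t" by (rule \<mu>) fact
    note \<mu>(2)[OF t, measurable_cong]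
    have Z_b: "(\<lambda>s. Z s b) \<in> borel_measurable \<tau>"
      using measurable_compose[OF _ Z_borel, of "\<lambda>s. (s, b)" \<tau>] by simp
    then have Zb_int: "integrable \<tau> (\<lambda>s. Z s b)"
      using Z_bound sp\<tau> by (intro t.integrable_const_bound[where B = "(\<Sum>i\<in>UNIV. exp (\<bar>c (k i)\<bar> * t)) * norm b"]) auto
    \<comment> \<open>The cut-off in \<open>levy_exponent\<close> acts on \<open>x\<close> and not
      on \<open>T s x\<close>, so the drift of the projected law is just the time integral of the
      projected \<open>T s b\<close>.\<close>
    define a where "a = (LINT s|\<tau>. Z s b)"
    have exponent: "levy_exponent b M (adjoint (blinfun_apply (T s)) (\<xi> \<eta>))
      = - (\<i> * complex_of_real (Z s b \<bullet> \<eta>)) - (LINT x|M. levy_integrand (Z s x \<bullet> \<eta>) (norm x < 1))"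
      if "0 \<le> s" for s \<eta>
    proof -
      have "x \<bullet> adjoint (T s) (\<xi> \<eta>) = Z s x \<bullet> \<eta>" for x
        using that by (simp add: adj \<pi>_\<xi> \<pi>_T)
      moreover have "(indicator (ball 0 1) x :: real) = of_bool (norm x < 1)" for x :: 'a by (simp add: indicator_def)
      ultimately show ?thesis
        by (simp only: levy_exponent_def levy_integrand_def inner_commute[of "adjoint (T s) (\<xi> \<eta>)" b])
    qed
    have "char_fun (distr (\<mu> t) borel \<pi>) \<eta> = exp (\<i> * complex_of_real (a \<bullet> \<eta>) +
        (LINT s|\<tau>. LINT x|M. levy_integrand (Z s x \<bullet> \<eta>) (norm x < 1)))" for \<eta>
    proof -
      have "(LINT s:{0..t}|lborel. levy_exponent b M (adjoint (blinfun_apply (T s)) (\<xi> \<eta>)))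
        = (LINT s|\<tau>. levy_exponent b M (adjoint (blinfun_apply (T s)) (\<xi> \<eta>)))"
        unfolding \<tau>_def set_lebesgue_integral_def by (subst integral_restrict_space) auto
      also have "\<dots> = (LINT s|\<tau>. - (\<i> * complex_of_real (Z s b \<bullet> \<eta>)) - (LINT x|M. levy_integrand (Z s x \<bullet> \<eta>) (norm x < 1)))"
        by (rule Bochner_Integration.integral_cong[OF refl]) (rule exponent, simp add: sp\<tau>)
      also have "\<dots> = - (\<i> * complex_of_real (a \<bullet> \<eta>)) - (LINT s|\<tau>. LINT x|M. levy_integrand (Z s x \<bullet> \<eta>) (norm x < 1))"
        using levy_integral_integrable Zb_int by (simp add: a_def)
      finally show ?thesis by (simp add: char_distr \<mu>[OF t] char_\<mu>[OF t] add.commute)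
    qed
    then show ?thesis unfolding R_def
    proof (rule ent_le_levy_energy[OF _ _ _ \<pi> \<pi>_bound G_lip G _ C, rotated 2])
      show "(\<integral>\<^sup>+s. \<integral>\<^sup>+x. \<phi> (Z s x) \<partial>M \<partial>\<tau>) \<le> ennreal C * (\<integral>\<^sup>+x. \<phi> (\<pi> x) \<partial>M)"
        if "\<phi> \<in> borel_measurable borel" for \<phi> :: "real ^ 'n \<Rightarrow> ennreal"
        unfolding \<tau>_def by (rule dom) (rule that)
      show "prob_space (distr (\<mu> t) borel \<pi>)" by (rule m.prob_space_distr) measurable
    qed simp
  qed

  have G_cont: "continuous_on UNIV G" by (rule lipschitz_continuous[OF G_all])
  have R_cont: "continuous_on UNIV R" unfolding R_def by (rule levy_energy_continuous[OF G_all])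
  have G_meas [measurable]: "G \<in> borel_measurable borel" by (rule borel_measurable_continuous_onI) (rule G_cont)
  have R_meas [measurable]: "R \<in> borel_measurable borel" by (rule borel_measurable_continuous_onI) (rule R_cont)
  have "ent (distr \<sigma> borel \<pi>) G \<le> C * (LINT u|distr \<sigma> borel \<pi>. R u)"
  \<comment> \<open>The bound at each integer time already has the final constant, so only the
    measures vary.\<close>
  proof (rule ent_le_limit[where N = "\<lambda>n. distr (\<mu> (real n)) borel \<pi>" and C = "\<lambda>_. C"])
    show "prob_space (distr (\<mu> (real n)) borel \<pi>)" for n
    proof (rule prob_space.prob_space_distr[OF \<mu>(1)])
      show "\<pi> \<in> \<mu> (real n) \<rightarrow>\<^sub>M borel" using \<pi> by (simp add: \<mu>(2) cong: measurable_cong_sets)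
    qed simp
    show "prob_space (distr \<sigma> borel \<pi>)" by (rule S.prob_space_distr) measurable
    show "(\<lambda>n. char_fun (distr (\<mu> (real n)) borel \<pi>) \<eta>) \<longlonglongrightarrow> char_fun (distr \<sigma> borel \<pi>) \<eta>" for \<eta>
      using invariant_char_fun_tendsto[OF \<mu> assms(14) assms(10), of "\<xi> \<eta>"]
      by (simp add: char_distr \<mu> s\<sigma>)
    show "\<bar>R u\<bar> \<le> ((B0 powr p)\<^sup>2 + (\<bar>p * B0 powr (p - 1) * L\<bar> * (\<Sum>i\<in>(UNIV :: 'n set). exp (\<bar>c (k i)\<bar> * 0)))\<^sup>2)
        / c0 powr p * (LINT x|M. min 1 ((norm x)\<^sup>2))" for u
      unfolding R_def by (rule levy_energy_bounded[OF G_all])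
  qed (use G_cont R_cont G step in auto)
  moreover have "ent (distr \<sigma> borel \<pi>) G = ent \<sigma> (\<lambda>x. f x powr p)"
    unfolding ent_def fG by (simp add: integral_distr)
  moreover have "(LINT u|distr \<sigma> borel \<pi>. R u)
    = (LINT x|\<sigma>. LINT y|M. \<bar>f (x + y) powr p - f x powr p\<bar>\<^sup>2 / f x powr p)"
  proof -
    have "(LINT u|distr \<sigma> borel \<pi>. R u) = (LINT x|\<sigma>. R (\<pi> x))" by (rule integral_distr) measurable
    then show ?thesis by (simp add: R_def fG \<pi>_add)
  qed
  ultimately show ?thesis by (simp add: C_def)
qed

end
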